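(* Let $n\ge 3$, and let $K_i$ and $K_o$ be regular $n$-gons in $\mathbb{R}^2$ such that each vertex of $K_i$ lies on a side of $K_o$ and $K_i$, $K_o$ have a common centroid $z$. If $K\subset\mathbb{R}^2$ is a convex body with $o\in\operatorname{int}K$ and $K_i\subset K\subset K_o$, then $$|K|\cdot|K^*|\ge n^2\sin^2(\pi/n),$$ with equality if and only if $o=z$ and either $K=K_i$ or $K=K_o$.
   Context: $o$ is the origin of $\mathbb{R}^2$, $\langle\cdot,\cdot\rangle$ the scalar product, $|\cdot|$ denotes area. A convex body is a compact convex set with non-empty interior. For a convex body $K$ with $o\in\operatorname{int}K$ the polar is $K^*=\{x\in\mathbb{R}^2:\ \langle x,y\rangle\le 1\ \text{for all } y\in K\}$. Polygons are understood as closed two-dimensional convex regions. *)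

theory Defs
  imports "HOL-Analysis.Analysis"
begin

definition convex_body :: "(real^2) set \<Rightarrow> bool" where
  "convex_body K \<longleftrightarrow> convex K \<and> compact K \<and> interior K \<noteq> {}"

definition polar :: "(real^2) set \<Rightarrow> (real^2) set" where
  "polar K = {x. \<forall>y\<in>K. x \<bullet> y \<le> 1}"

definition area :: "(real^2) set \<Rightarrow> real" where
  "area S = measure lebesgue S"

definition centroid :: "(real^2) set \<Rightarrow> real^2" where
  "centroid S = (1 / area S) *\<^sub>R integral S (\<lambda>x. x)"

(* The n corner points are equally spaced on a circle with arbitrary centre c, radius r > 0
   and phase t. Used for n \<ge> 3 only. *)
definition regular_ngon :: "nat \<Rightarrow> (real^2) set \<Rightarrow> bool" where
  "regular_ngon n P \<longleftrightarrow> (\<exists>c r t. r > 0 \<and>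
     P = convex hull ((\<lambda>k. c + r *\<^sub>R vector [cos (t + 2 * pi * real k / real n),
                                         sin (t + 2 * pi * real k / real n)]) ` {..<n}))"

end

theory Submission
  imports Defs
begin

text \<open>
  Write the vertices of the inner polygon as \<open>v\<^sub>k\<close>, numbered so that \<open>v\<^sub>k\<close> lies on the \<open>k\<close>-th side of
  the outer polygon, and let \<open>u\<^sub>k\<close> be the point of the polar body dual to the line of that side, so that
  \<open>\<langle>u\<^sub>k, v\<^sub>k\<rangle> = 1\<close>. Both bodies are cut into \<open>n\<close> pieces: \<open>K\<close> along the chords from \<open>v\<^sub>k\<close> to \<open>v\<^sub>k\<^sub>+\<^sub>1\<close>, and \<open>K\<^sup>*\<close>
  along the chords from \<open>u\<^sub>k\<close> to \<open>u\<^sub>k\<^sub>+\<^sub>1\<close>. The \<open>k\<close>-th piece consists of the triangle with apex \<open>o\<close> over the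
  chord (with signed area) and the part of the body strictly beyond the chord, its cap. Let \<open>A\<^sub>k\<close> and
  \<open>B\<^sub>k\<close> be twice the resulting signed areas; their sums are at most \<open>2|K|\<close> and \<open>2|K\<^sup>*|\<close>. Signed areas
  matter because \<open>o\<close> may lie in \<open>K\<close> outside the inner polygon.

  The local estimate is \<open>bulge_product\<close>. If \<open>x \<in> K\<close> lies beyond the chord from \<open>a\<close> to \<open>b\<close>, the cap contains
  the triangle \<open>a x b\<close>; hence the linear functional which is constant on the chord with value \<open>det (a, b)\<close> is
  at most \<open>A\<close> on all of \<open>K\<close>. Divided by \<open>A\<close> it is a point \<open>q\<close> of \<open>K\<^sup>*\<close>. In the same way the chord of \<open>K\<^sup>*\<close> from
  \<open>u\<close> to \<open>u'\<close> gives a point \<open>x\<close> of \<open>K\<close>, and \<open>\<langle>q, x\<rangle> \<le> 1\<close> says exactly that \<open>\<langle>a - b, u - u'\<rangle> \<le> A B\<close>.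

  If \<open>z\<close> is the common centroid and \<open>h\<^sub>k\<close> the distance from \<open>o\<close> to the \<open>k\<close>-th side line, then
  \<open>\<langle>v\<^sub>k - v\<^sub>k\<^sub>+\<^sub>1, u\<^sub>k - u\<^sub>k\<^sub>+\<^sub>1\<rangle> = \<alpha> / h\<^sub>k\<^sub>+\<^sub>1 + \<beta> / h\<^sub>k\<close> with constants \<open>\<alpha>, \<beta> \<ge> 0\<close> satisfying
  \<open>\<alpha> + \<beta> = 4 h sin\<^sup>2 (\<pi> / n)\<close>, where \<open>h\<close> is the mean of the \<open>h\<^sub>k\<close>. Convexity of \<open>t \<mapsto> 1 / t\<close> and a weighted
  Cauchy-Schwarz inequality (\<open>weighted_cauchy_schwarz\<close>) combine the local estimates to
  \<open>(\<Sum>A\<^sub>k) (\<Sum>B\<^sub>k) \<ge> 4 n\<^sup>2 sin\<^sup>2 (\<pi> / n)\<close>, for every position of \<open>o\<close>.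

  In the equality case the weights show \<open>z = o\<close>, all \<open>A\<^sub>k\<close> coincide, all \<open>B\<^sub>k\<close> coincide, and every local
  estimate is sharp. A sharp local estimate forces one of the two caps to be empty
  (\<open>bulge_product_equality\<close>): otherwise both caps are triangles, but an edge of the triangle in \<open>K\<close> is
  dual to a point of the cap in \<open>K\<^sup>*\<close> outside the triangle there. Since the pieces all have the same
  area, either all caps of \<open>K\<close> are empty and \<open>K\<close> is the inner polygon, or all caps of \<open>K\<^sup>*\<close> are empty and
  \<open>K\<close> is the outer one. Conversely, a regular \<open>n\<close>-gon centred at \<open>o\<close> and its polar are both
  contained in an intersection of \<open>n\<close> equally spaced half-planes at equal distance from \<open>o\<close>, which bounds
  the product of the areas from above.
\<close>

section \<open>Determinants, triangles and caps in the plane\<close>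

definition det2 :: "real^2 \<Rightarrow> real^2 \<Rightarrow> real" where
  "det2 x y = x$1 * y$2 - x$2 * y$1"

text \<open>The quarter turn. It represents the functional \<open>det2 w\<close> as a scalar product, which is how lines and
  chords become points of the polar body.\<close>

definition perp :: "real^2 \<Rightarrow> real^2" where
  "perp w = vector [- (w$2), w$1]"

definition dir :: "real \<Rightarrow> real^2" where
  "dir t = vector [cos t, sin t]"

text \<open>The functional \<open>det2 (a - b)\<close> takes the value \<open>det2 a b\<close> on the whole line through \<open>a\<close> and \<open>b\<close>. The inequality
  is strict, so that a cap of a polygon is empty when the chord is one of its edges, and so that caps stay
  inside their sectors even if a chord lies on the boundary.\<close>

definition cap :: "(real^2) set \<Rightarrow> real^2 \<Rightarrow> real^2 \<Rightarrow> (real^2) set" where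
  "cap M a b = {x \<in> M. det2 (a - b) x > det2 a b}"

lemma inner2: "(x::real^2) \<bullet> y = x$1 * y$1 + x$2 * y$2"
  by (simp add: inner_vec_def sum_2)

lemma vec2_eq_iff: "(x::real^2) = y \<longleftrightarrow> x$1 = y$1 \<and> x$2 = y$2"
  by (simp add: vec_eq_iff forall_2)

lemma perp_inner: "perp w \<bullet> v = det2 w v"
  by (simp add: perp_def det2_def inner2)

lemma det2_perp: "det2 w (perp v) = w \<bullet> v"
  by (simp add: perp_def det2_def inner2)

lemma perp_eq_0_iff: "perp w = 0 \<longleftrightarrow> w = 0"
  by (auto simp: perp_def vec2_eq_iff)

lemma det2_add_left: "det2 (x + y) z = det2 x z + det2 y z"
  and det2_add_right: "det2 z (x + y) = det2 z x + det2 z y"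
  and det2_diff_left: "det2 (x - y) z = det2 x z - det2 y z"
  and det2_diff_right: "det2 z (x - y) = det2 z x - det2 z y"
  and det2_scale_left: "det2 (r *\<^sub>R x) y = r * det2 x y"
  and det2_scale_right: "det2 x (r *\<^sub>R y) = r * det2 x y"
  and det2_self: "det2 x x = 0"
  and det2_zero_left: "det2 0 x = 0"
  and det2_zero_right: "det2 x 0 = 0"
  by (simp_all add: det2_def algebra_simps)

lemmas det2_simps = det2_add_left det2_add_right det2_diff_left det2_diff_right
  det2_scale_left det2_scale_right det2_self det2_zero_left det2_zero_right

lemma det2_swap: "det2 y x = - det2 x y"
  by (simp add: det2_def)

lemma dir_inner: "dir s \<bullet> dir t = cos (s - t)"
  by (simp add: dir_def inner2 cos_diff)

lemma dir_det2: "det2 (dir s) (dir t) = sin (t - s)"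
  by (simp add: dir_def det2_def sin_diff algebra_simps)

lemma norm_dir [simp]: "norm (dir t) = 1"
  by (simp add: norm_eq_sqrt_inner dir_inner)

lemma continuous_on_det2 [continuous_intros]:
  "continuous_on S f \<Longrightarrow> continuous_on S g \<Longrightarrow> continuous_on S (\<lambda>x. det2 (f x) (g x))"
  unfolding det2_def by (intro continuous_intros)

lemma area_triangle: "area (convex hull {a, b, c}) = \<bar>det2 (b - a) (c - a)\<bar> / 2"
proof -
  have "convex hull {a, b, c} \<in> sets lborel"
    by (simp add: borel_compact finite_imp_compact_convex_hull)
  then have "area (convex hull {a, b, c}) = measure lborel (convex hull {a, b, c})"
    by (simp add: area_def)
  then show ?thesis
    by (simp add: content_triangle det2_def abs_minus_commute mult.commute)
qed

lemma triangle_lmeasurable [simp]: "convex hull {a, b, c :: real^2} \<in> lmeasurable"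
  by (simp add: lmeasurable_compact finite_imp_compact_convex_hull)

lemma area_mono: "S \<subseteq> T \<Longrightarrow> S \<in> lmeasurable \<Longrightarrow> T \<in> lmeasurable \<Longrightarrow> area S \<le> area T"
  unfolding area_def by (rule measure_mono_fmeasurable) auto

lemma negligible_det2_line:
  assumes "w \<noteq> 0" shows "negligible {x. det2 w x = d}"
proof -
  have "{x. det2 w x = d} = {x. perp w \<bullet> x = d}" by (simp add: perp_inner)
  then show ?thesis using assms by (simp add: negligible_hyperplane perp_eq_0_iff)
qed

lemma convex_det2_gt: "convex {x. det2 w x > d}"
  using convex_halfspace_gt[of d "perp w"] by (simp add: perp_inner)

lemma convex_det2_ge: "convex {x. det2 w x \<ge> d}"
  using convex_halfspace_ge[of d "perp w"] by (simp add: perp_inner)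

lemma convex_det2_ge_left: "convex {x. det2 x w \<ge> d}"
  using convex_halfspace_le[of "perp w" "-d"] det2_swap[of _ w]
  by (simp add: perp_inner le_minus_iff)

lemma cap_subset: "cap M a b \<subseteq> M" by (auto simp: cap_def)

lemma convex_cap: "convex M \<Longrightarrow> convex (cap M a b)"
  using convex_Int[OF _ convex_det2_gt] by (simp add: cap_def Collect_conj_eq)

lemma cap_lmeasurable:
  assumes "convex M" "M \<in> lmeasurable" shows "cap M a b \<in> lmeasurable"
proof -
  have "open {x. det2 (a - b) x > det2 a b}"
    by (intro open_Collect_less continuous_intros)
  then have "M \<inter> {x. det2 (a - b) x > det2 a b} \<in> lmeasurable"
    by (intro fmeasurable_Int_fmeasurable assms) auto
  then show ?thesis by (simp add: cap_def Collect_conj_eq)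
qed

lemma cap_triangle:
  assumes M: "convex M" and abx: "a \<in> M" "b \<in> M" "x \<in> cap M a b"
  shows "convex hull {a, x, b} \<subseteq> cap M a b \<union> {y. det2 (a - b) y = det2 a b}"
    and "area (convex hull {a, x, b}) = (det2 (a - b) x - det2 a b) / 2"
proof -
  have "convex hull {a, x, b} \<subseteq> M \<inter> {y. det2 (a - b) y \<ge> det2 a b}"
    using abx by (intro hull_minimal convex_Int M convex_det2_ge)
      (auto simp: cap_def det2_simps det2_swap[of b a])
  then show "convex hull {a, x, b} \<subseteq> cap M a b \<union> {y. det2 (a - b) y = det2 a b}"
    by (auto simp: cap_def)
  have "det2 (x - a) (b - a) = det2 (a - b) x - det2 a b"
    by (simp add: det2_def algebra_simps)
  then show "area (convex hull {a, x, b}) = (det2 (a - b) x - det2 a b) / 2"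
    using abx by (simp add: area_triangle cap_def)
qed

text \<open>The triangle spanned by the chord and \<open>x\<close> lies in the cap up to the line of the chord, so the height of \<open>x\<close>
  over the chord is controlled by the area of the cap.\<close>

lemma chord_bound:
  assumes M: "convex M" "M \<in> lmeasurable" and abx: "a \<in> M" "b \<in> M" "x \<in> M"
  shows "det2 (a - b) x \<le> det2 a b + 2 * area (cap M a b)"
proof (cases "x \<in> cap M a b")
  case False
  then have "det2 (a - b) x \<le> det2 a b" using abx by (auto simp: cap_def)
  moreover have "0 \<le> area (cap M a b)" by (simp add: area_def)
  ultimately show ?thesis by linarith
next
  case True
  let ?L = "{y. det2 (a - b) y = det2 a b}"
  have ab: "a - b \<noteq> 0" using True by (auto simp: cap_def det2_simps)
  have neg: "negligible ?L" by (rule negligible_det2_line[OF ab])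
  have cm: "cap M a b \<in> lmeasurable" by (rule cap_lmeasurable[OF M])
  have "area (convex hull {a, x, b}) = area (convex hull {a, x, b} - ?L)"
    unfolding area_def using neg
    by (intro measure_negligible_symdiff[symmetric]) (auto intro: negligible_subset)
  also have "\<dots> \<le> area (cap M a b)"
    unfolding area_def
    by (rule measure_mono_fmeasurable)
      (use cap_triangle(1)[OF M(1) abx(1,2) True] cm neg in
        \<open>auto intro!: sets.Diff simp: fmeasurableD negligible_imp_sets\<close>)
  finally show ?thesis using cap_triangle(2)[OF M(1) abx(1,2) True] by simp
qed

text \<open>A point of \<open>P\<close> outside the closed set \<open>T\<close> is a limit of interior points of \<open>P\<close>, so it would contribute a
  nonempty open set to \<open>P - T\<close>, and \<open>P\<close> would have larger area than \<open>T\<close>.\<close>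

lemma convex_subset_of_area_eq:
  assumes T: "closed T" "T \<in> lmeasurable" and P: "convex P" "P \<in> lmeasurable"
    and int: "interior P \<noteq> {}"
    and TP: "negligible (T - P)" and eq: "area P \<le> area T"
  shows "P \<subseteq> T"
proof (rule ccontr)
  assume "\<not> P \<subseteq> T"
  then obtain p where p: "p \<in> P" "p \<notin> T" by auto
  have "P \<subseteq> closure (interior P)"
    using convex_closure_interior[OF P(1) int] closure_subset by auto
  then have "p \<in> closure (interior P)" using p by auto
  moreover have "open (- T)" "p \<in> - T" using T p by auto
  ultimately have ne: "interior P \<inter> - T \<noteq> {}"
    using open_Int_closure_eq_empty by (metis IntI Int_commute emptyE)
  have op: "open (interior P \<inter> - T)" using \<open>open (- T)\<close> by auto
  have "\<not> negligible (P - T)"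
    using open_not_negligible[OF op ne] interior_subset[of P]
    by (meson Diff_iff IntE ComplD negligible_subset subsetI subset_iff)
  moreover have "P - T \<in> lmeasurable" using P T by (simp add: fmeasurable_Diff fmeasurableD)
  ultimately have pos: "0 < measure lebesgue (P - T)"
    by (simp add: zero_less_measure_iff negligible_iff_measure)
  have "measure lebesgue P = measure lebesgue (P \<inter> T) + measure lebesgue (P - T)"
    using measure_Un2[of "P \<inter> T" lebesgue P] P T
    by (simp add: fmeasurable_Int_fmeasurable fmeasurableD Un_absorb1 Diff_Int)
  moreover have "measure lebesgue T = measure lebesgue (P \<inter> T)"
    using TP T
    by (intro measure_negligible_symdiff[symmetric]) (auto intro: negligible_subset)
  ultimately show False using pos eq by (simp add: area_def)
qed

section \<open>Dual chords and the local estimate\<close>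

text \<open>Twice the area of the piece of \<open>M\<close> between the segments from the origin to \<open>a\<close> and to \<open>b\<close>. The determinant is kept
  with its sign: a negative value is right when the origin lies on the same side of the chord as the cap.\<close>

definition bulge :: "(real^2) set \<Rightarrow> real^2 \<Rightarrow> real^2 \<Rightarrow> real" where
  "bulge M a b = det2 a b + 2 * area (cap M a b)"

lemma polarD: "y \<in> polar K \<Longrightarrow> x \<in> K \<Longrightarrow> y \<bullet> x \<le> 1"
  by (simp add: polar_def)

lemma convex_polar: "convex (polar K)"
proof -
  have "polar K = (\<Inter>y\<in>K. {x. y \<bullet> x \<le> 1})" by (auto simp: polar_def inner_commute)
  then show ?thesis by (simp add: convex_INT convex_halfspace_le)
qed

lemma closed_polar: "closed (polar K)"
proof -
  have "polar K = (\<Inter>y\<in>K. {x. y \<bullet> x \<le> 1})" by (auto simp: polar_def inner_commute)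
  then show ?thesis by (simp add: closed_INT closed_halfspace_le)
qed

lemma compact_polar:
  assumes "0 \<in> interior K" shows "compact (polar K)"
proof -
  obtain e where e: "e > 0" "cball 0 e \<subseteq> K" using assms by (auto simp: mem_interior_cball)
  have "norm y \<le> 1 / e" if "y \<in> polar K" for y
  proof (cases "y = 0")
    case False
    have "(e / norm y) *\<^sub>R y \<in> K" using e False by auto
    then have "y \<bullet> ((e / norm y) *\<^sub>R y) \<le> 1" using that by (rule polarD[rotated])
    then have "e * norm y \<le> 1" using False by (simp add: power2_norm_eq_inner[symmetric] power2_eq_square)
    then show ?thesis using e by (simp add: field_simps)
  qed (use e in auto)
  then have "bounded (polar K)" by (auto simp: bounded_iff)
  then show ?thesis using closed_polar compact_eq_bounded_closed by blast
qed

lemma zero_interior_polar: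
  assumes "bounded K" shows "0 \<in> interior (polar K)"
proof -
  obtain r where r: "r > 0" "\<And>x. x \<in> K \<Longrightarrow> norm x \<le> r" using assms by (auto simp: bounded_pos)
  have "cball 0 (1 / r) \<subseteq> polar K"
  proof
    fix y :: "real^2" assume "y \<in> cball 0 (1 / r)"
    then have y: "norm y \<le> 1 / r" by simp
    have "y \<bullet> x \<le> 1" if "x \<in> K" for x
    proof -
      have "y \<bullet> x \<le> norm y * norm x" by (rule norm_cauchy_schwarz)
      also have "\<dots> \<le> (1 / r) * r" using y r(2)[OF that] r(1) by (intro mult_mono) auto
      finally show ?thesis using r(1) by simp
    qed
    then show "y \<in> polar K" by (simp add: polar_def)
  qed
  then show ?thesis using r(1) by (auto simp: mem_interior_cball intro!: exI[of _ "1/r"])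
qed

lemma polar_polar:
  assumes "convex K" "closed K" "0 \<in> K" shows "polar (polar K) = K"
proof
  show "K \<subseteq> polar (polar K)" by (auto simp: polar_def inner_commute)
  show "polar (polar K) \<subseteq> K"
  proof (rule subsetI, rule ccontr)
    fix x assume x: "x \<in> polar (polar K)" "x \<notin> K"
    obtain a b where ab: "a \<bullet> x < b" "\<And>y. y \<in> K \<Longrightarrow> b < a \<bullet> y"
      using separating_hyperplane_closed_point[OF assms(1,2) x(2)] by blast
    have b: "b < 0" using ab(2)[OF assms(3)] by simp
    have "(1 / b) *\<^sub>R a \<in> polar K"
      unfolding polar_def using ab(2) b by (auto simp: field_simps less_imp_le)
    then have "x \<bullet> ((1 / b) *\<^sub>R a) \<le> 1" using x(1) by (rule polarD[rotated])
    then show False using ab(1) b by (simp add: field_simps inner_commute)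
  qed
qed

text \<open>By \<open>chord_bound\<close> the functional \<open>det2 (a - b)\<close> is bounded by \<open>bulge K a b\<close> on \<open>K\<close>. As the origin is interior, this
  functional is positive somewhere on \<open>K\<close>; hence the bound is positive, whatever the sign of \<open>det2 a b\<close>.\<close>

lemma perp_chord_in_polar:
  assumes K: "convex K" "compact K" "0 \<in> interior K" and ab: "a \<in> K" "b \<in> K" "a \<noteq> b"
  shows "0 < bulge K a b" "(1 / bulge K a b) *\<^sub>R perp (a - b) \<in> polar K"
proof -
  have bound: "det2 (a - b) x \<le> bulge K a b" if "x \<in> K" for x
    unfolding bulge_def using chord_bound[OF K(1) lmeasurable_compact[OF K(2)] ab(1,2) that] .
  obtain e where e: "e > 0" "cball 0 e \<subseteq> K" using K(3) by (auto simp: mem_interior_cball)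
  define x where "x = (e / norm (perp (a - b))) *\<^sub>R perp (a - b)"
  have ne: "perp (a - b) \<noteq> 0" using ab by (simp add: perp_eq_0_iff)
  have "x \<in> K" using e ne by (auto simp: x_def)
  moreover have "det2 (a - b) x > 0"
    using ne e ab by (simp add: x_def det2_scale_right det2_perp)
  ultimately show pos: "0 < bulge K a b" using bound by force
  show "(1 / bulge K a b) *\<^sub>R perp (a - b) \<in> polar K"
    using bound pos by (auto simp: polar_def perp_inner field_simps)
qed

text \<open>The preceding lemma for the polar body, carried back to \<open>K\<close> by the bipolar theorem.\<close>

lemma perp_dual_chord_in_body:
  assumes K: "convex K" "compact K" "0 \<in> interior K"
    and uv: "u \<in> polar K" "v \<in> polar K" "u \<noteq> v"
  shows "0 < bulge (polar K) u v" "(1 / bulge (polar K) u v) *\<^sub>R perp (u - v) \<in> K"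
proof -
  have "0 \<in> K" "closed K" using K interior_subset compact_imp_closed by auto
  then have pp: "polar (polar K) = K" using K polar_polar by simp
  have "bounded K" using K compact_imp_bounded by auto
  note * = perp_chord_in_polar[OF convex_polar compact_polar[OF K(3)]
      zero_interior_polar[OF this] uv, unfolded pp]
  show "0 < bulge (polar K) u v" "(1 / bulge (polar K) u v) *\<^sub>R perp (u - v) \<in> K"
    using * by auto
qed

text \<open>The two preceding lemmas turn the chords into a point of \<open>polar K\<close> and a point of \<open>K\<close>; their scalar product
  is at most 1. Quarter turns preserve scalar products, so it equals
  \<open>(a - b) \<bullet> (u - v)\<close> divided by the product of the two bulges.\<close>

lemma bulge_product:
  assumes K: "convex K" "compact K" "0 \<in> interior K"
    and ab: "a \<in> K" "b \<in> K" "a \<noteq> b" and uv: "u \<in> polar K" "v \<in> polar K" "u \<noteq> v"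
  shows "(a - b) \<bullet> (u - v) \<le> bulge K a b * bulge (polar K) u v"
proof -
  note q = perp_chord_in_polar[OF K ab] and x = perp_dual_chord_in_body[OF K uv]
  have "((1 / bulge K a b) *\<^sub>R perp (a - b)) \<bullet> ((1 / bulge (polar K) u v) *\<^sub>R perp (u - v)) \<le> 1"
    using polarD[OF q(2) x(2)] .
  then show ?thesis using q(1) x(1) by (simp add: perp_inner det2_perp field_simps)
qed

text \<open>If \<open>x\<close> attains the bound of \<open>chord_bound\<close>, then the triangle \<open>a x b\<close> has the full area of the cap.\<close>

lemma cap_subset_triangle:
  assumes M: "convex M" "compact M" "interior M \<noteq> {}" and ab: "a \<in> M" "b \<in> M"
    and x: "x \<in> cap M a b" and max: "det2 (a - b) x = bulge M a b"
  shows "cap M a b \<subseteq> convex hull {a, x, b}"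
proof (rule convex_subset_of_area_eq)
  let ?T = "convex hull {a, x, b}"
  have ne: "a - b \<noteq> 0" using x by (auto simp: cap_def det2_simps)
  note tri = cap_triangle[OF M(1) ab x]
  show "closed ?T" by (simp add: compact_imp_closed finite_imp_compact_convex_hull)
  show "convex (cap M a b)" "cap M a b \<in> lmeasurable"
    using M by (auto intro: convex_cap cap_lmeasurable lmeasurable_compact)
  show "negligible (?T - cap M a b)"
    using negligible_subset[OF negligible_det2_line[OF ne]] tri(1) by blast
  show "area (cap M a b) \<le> area ?T" using tri(2) max by (simp add: bulge_def)
  let ?U = "{y. det2 (a - b) y > det2 a b}"
  have opU: "open ?U" by (intro open_Collect_less continuous_intros)
  have "x \<in> closure (interior M)" "x \<in> ?U"
    using x convex_closure_interior[OF M(1,3)] closure_subset by (auto simp: cap_def)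
  then have "?U \<inter> interior M \<noteq> {}" using opU open_Int_closure_eq_empty by blast
  moreover have "?U \<inter> interior M \<subseteq> interior (cap M a b)"
    using opU interior_subset[of M] by (intro interior_maximal) (auto simp: cap_def)
  ultimately show "interior (cap M a b) \<noteq> {}" by auto
qed simp

text \<open>Suppose that both caps are nonempty. The points \<open>q \<in> polar K\<close> and \<open>x \<in> K\<close> that prove \<open>bulge_product\<close> then lie
  in the caps and attain their bounds, so both caps are triangles, with apexes \<open>x\<close> and \<open>q\<close>. Let \<open>y\<close> be dual to
  the line through \<open>x\<close> and \<open>b\<close>. Because the cap of \<open>K\<close> is a triangle, this line supports \<open>K\<close>, so \<open>y \<in> polar K\<close>, and \<open>y\<close>
  lies in the other cap. But the only point of the triangle \<open>u q v\<close> on the line dual to \<open>b\<close> is \<open>v\<close>, which is not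
  in the cap.\<close>

lemma bulge_product_equality:
  assumes K: "convex K" "compact K" "0 \<in> interior K"
    and ab: "a \<in> K" "b \<in> K" and uv: "u \<in> polar K" "v \<in> polar K"
    and incident: "u \<bullet> a = 1" "v \<bullet> b = 1" and det: "det2 a b > 0"
    and eq: "(a - b) \<bullet> (u - v) = bulge K a b * bulge (polar K) u v"
  shows "cap K a b = {} \<or> cap (polar K) u v = {}"
proof (rule ccontr)
  assume "\<not> ?thesis"
  then obtain x0 y0 where x0: "x0 \<in> cap K a b" and y0: "y0 \<in> cap (polar K) u v" by auto
  have ne: "a \<noteq> b" "u \<noteq> v" using x0 y0 by (auto simp: cap_def det2_simps)
  define A where "A = bulge K a b"
  define B where "B = bulge (polar K) u v"
  define q where "q = (1 / A) *\<^sub>R perp (a - b)"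
  define x where "x = (1 / B) *\<^sub>R perp (u - v)"
  have A: "A > 0" and q: "q \<in> polar K" using perp_chord_in_polar[OF K ab ne(1)] by (auto simp: A_def q_def)
  have B: "B > 0" and x: "x \<in> K" using perp_dual_chord_in_body[OF K uv ne(2)] by (auto simp: B_def x_def)
  have eq': "(a - b) \<bullet> (u - v) = A * B" using eq by (simp add: A_def B_def)
  have "bounded K" using K compact_imp_bounded by auto
  then have polK: "convex (polar K)" "compact (polar K)" "interior (polar K) \<noteq> {}"
    using convex_polar compact_polar[OF K(3)] zero_interior_polar by auto
  have "det2 (a - b) x0 \<le> A"
    unfolding A_def bulge_def using x0 chord_bound[OF K(1) lmeasurable_compact[OF K(2)] ab]
    by (auto simp: cap_def)
  then have dA: "det2 a b < A" using x0 by (auto simp: cap_def)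
  have "det2 (u - v) y0 \<le> B"
    unfolding B_def bulge_def using y0 chord_bound[OF polK(1) lmeasurable_compact[OF polK(2)] uv]
    by (auto simp: cap_def)
  then have dB: "det2 u v < B" using y0 by (auto simp: cap_def)
  have xA: "det2 (a - b) x = A" using eq' B by (simp add: x_def det2_simps det2_perp field_simps)
  have qB: "det2 (u - v) q = B" using eq' A
    by (simp add: q_def det2_simps det2_perp field_simps inner_commute)
  have xcap: "x \<in> cap K a b" using x xA dA by (simp add: cap_def)
  have qcap: "q \<in> cap (polar K) u v" using q qB dB by (simp add: cap_def)
  have Ksub: "cap K a b \<subseteq> convex hull {a, x, b}"
    using K by (intro cap_subset_triangle ab xcap) (auto simp: xA A_def)
  have Psub: "cap (polar K) u v \<subseteq> convex hull {u, q, v}"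
    using polK by (intro cap_subset_triangle uv qcap) (auto simp: qB B_def)
  \<comment> \<open>If \<open>u \<bullet> b = 1\<close>, then \<open>u\<close> supports \<open>K\<close> along the whole chord and nothing of \<open>K\<close> lies beyond it.\<close>
  have ub: "u \<bullet> b < 1"
  proof (rule ccontr)
    assume "\<not> u \<bullet> b < 1"
    then have ub1: "u \<bullet> b = 1" using polarD[OF uv(1) ab(2)] by simp
    have "det2 (a - b) x = (u \<bullet> x) * det2 a b"
    proof -
      have "(u \<bullet> a) * det2 x b + (u \<bullet> b) * det2 a x = (u \<bullet> x) * det2 a b"
        by (simp add: inner2 det2_def algebra_simps)
      then show ?thesis using incident ub1 by (simp add: det2_simps det2_swap[of x b])
    qed
    also have "\<dots> \<le> 1 * det2 a b" using polarD[OF uv(1) x] det by (intro mult_right_mono) auto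
    finally show False using xA dA by simp
  qed
  have xb: "det2 x b = (1 - u \<bullet> b) / B"
  proof -
    have "det2 (perp (u - v)) b = v \<bullet> b - u \<bullet> b"
      by (simp add: perp_def det2_def inner2 algebra_simps)
    then show ?thesis using incident by (simp add: x_def det2_simps)
  qed
  have xb_pos: "det2 x b > 0" using xb ub B by simp
  define y where "y = (1 / det2 x b) *\<^sub>R perp (x - b)"
  have y_inner: "y \<bullet> w = det2 (x - b) w / det2 x b" for w
    by (simp add: y_def perp_inner)
  have yb: "y \<bullet> b = 1" and yx: "y \<bullet> x = 1" using xb_pos
    by (simp_all add: y_inner det2_simps det2_swap[of b x])
  have ya: "y \<bullet> a \<le> 1"
    using xb_pos xA dA by (simp add: y_inner det2_simps det2_swap[of a b] det2_swap[of a x] det2_swap[of b x])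
  have tri_le: "y \<bullet> w \<le> 1" if "w \<in> convex hull {a, x, b}" for w
  proof -
    have "convex hull {a, x, b} \<subseteq> {w. y \<bullet> w \<le> 1}"
      using ya yb yx by (intro hull_minimal) (auto simp: convex_halfspace_le)
    then show ?thesis using that by auto
  qed
  have "y \<in> polar K"
    unfolding polar_def
  proof (rule CollectI, rule ballI, rule ccontr)
    fix s assume s: "s \<in> K" "\<not> y \<bullet> s \<le> 1"
    \<comment> \<open>A point of \<open>K\<close> beyond the line through \<open>x\<close> and \<open>b\<close>, moved towards the midpoint of \<open>x\<close> and \<open>b\<close>,
      would enter the cap while staying outside the triangle.\<close>
    define m where "m = (1 / 2) *\<^sub>R x + (1 / 2) *\<^sub>R b"
    have m: "m \<in> K" unfolding m_def using K(1) x ab by (intro convexD) auto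
    have ym: "y \<bullet> m = 1" using yx yb by (simp add: m_def inner_add_right)
    have "det2 (a - b) b = det2 a b" by (simp add: det2_simps)
    then have mcap: "det2 (a - b) m > det2 a b" using xA dA by (simp add: m_def det2_add_right det2_scale_right)
    define g where "g = (\<lambda>t. det2 (a - b) ((1 - t) *\<^sub>R m + t *\<^sub>R s))"
    have g: "(g \<longlongrightarrow> g 0) (at_right 0)"
      unfolding g_def det2_def by (intro tendsto_intros)
    have "eventually (\<lambda>t. g t > det2 a b) (at_right 0)"
      using order_tendstoD(1)[OF g, of "det2 a b"] mcap by (simp add: g_def)
    moreover have "eventually (\<lambda>t::real. 0 < t \<and> t < 1) (at_right 0)"
      by (auto simp: eventually_at_right_field intro: exI[of _ 1])
    ultimately have "eventually (\<lambda>t. g t > det2 a b \<and> 0 < t \<and> t < 1) (at_right 0)"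
      by eventually_elim auto
    then obtain t where t: "g t > det2 a b" "0 < t" "t < 1"
      using eventually_happens'[OF trivial_limit_at_right_real] by blast
    have "(1 - t) *\<^sub>R m + t *\<^sub>R s \<in> K" using K(1) m s t by (intro convexD) auto
    then have "(1 - t) *\<^sub>R m + t *\<^sub>R s \<in> cap K a b" using t by (simp add: cap_def g_def)
    then have "y \<bullet> ((1 - t) *\<^sub>R m + t *\<^sub>R s) \<le> 1" using Ksub tri_le by blast
    then have "t * (y \<bullet> s) \<le> t" using ym by (simp add: inner_add_right)
    then show False using t s by simp
  qed
  moreover have yB: "det2 (u - v) y = B"
  proof -
    have "y \<bullet> x = det2 (u - v) y / B" by (simp add: x_def perp_inner inner_commute[of y])
    then show ?thesis using yx B by (simp add: field_simps)
  qed
  ultimately have "y \<in> cap (polar K) u v" using dB by (simp add: cap_def)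
  then have "y \<in> convex hull {u, q, v}" using Psub by auto
  then obtain \<alpha> \<beta> \<gamma> where c: "0 \<le> \<alpha>" "0 \<le> \<beta>" "0 \<le> \<gamma>" "\<alpha> + \<beta> + \<gamma> = 1"
    "y = \<alpha> *\<^sub>R u + \<beta> *\<^sub>R q + \<gamma> *\<^sub>R v" by (auto simp: convex_hull_3)
  have qb: "q \<bullet> b < 1" using A dA by (simp add: q_def perp_inner det2_simps)
  have "\<alpha> * (u \<bullet> b) + \<beta> * (q \<bullet> b) + \<gamma> = 1"
    using yb incident by (simp add: c(5) inner_add_left)
  then have "\<alpha> * (1 - u \<bullet> b) + \<beta> * (1 - q \<bullet> b) = 0" using c(4) by (simp add: algebra_simps)
  moreover have "0 \<le> \<alpha> * (1 - u \<bullet> b)" "0 \<le> \<beta> * (1 - q \<bullet> b)" using c ub qb by auto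
  ultimately have "\<alpha> * (1 - u \<bullet> b) = 0" "\<beta> * (1 - q \<bullet> b) = 0" by linarith+
  then have "\<alpha> = 0" "\<beta> = 0" using ub qb by auto
  then have "y = v" using c by simp
  then have "det2 (u - v) y = det2 u v" by (simp add: det2_simps)
  then show False using yB dB by simp
qed

section \<open>Equiangular sectors\<close>

text \<open>The directions of a regular \<open>n\<close>-gon. The index is not reduced modulo \<open>n\<close>, so that the last
  sector also lies between the spokes \<open>k\<close> and \<open>Suc k\<close>.\<close>

definition spoke :: "nat \<Rightarrow> real \<Rightarrow> nat \<Rightarrow> real^2" where
  "spoke n t k = dir (t + 2 * pi * real k / real n)"

lemma spoke_inner: "spoke n s j \<bullet> spoke n t k = cos (s - t + 2 * pi * (real j - real k) / real n)"
  by (simp add: spoke_def dir_inner algebra_simps diff_divide_distrib)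

lemma spoke_det2: "det2 (spoke n s j) (spoke n t k) = sin (t - s + 2 * pi * (real k - real j) / real n)"
  by (simp add: spoke_def dir_det2 algebra_simps diff_divide_distrib)

lemma spoke_last: "n > 0 \<Longrightarrow> spoke n t n = spoke n t 0"
  by (simp add: spoke_def dir_def)

lemma norm_spoke [simp]: "norm (spoke n t k) = 1"
  by (simp add: spoke_def)

lemma spoke_Suc_det2: "det2 (spoke n t k) (spoke n t (Suc k)) = sin (2 * pi / real n)"
  by (simp add: spoke_det2 algebra_simps)

lemma sin_2pi_div_pos: "n \<ge> 3 \<Longrightarrow> sin (2 * pi / real n) > 0"
  by (rule sin_gt_zero) (auto simp: field_simps)

lemma sin_pi_div_pos: "n \<ge> 3 \<Longrightarrow> sin (pi / real n) > 0"
  by (rule sin_gt_zero) (auto simp: field_simps)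

lemma cos_pi_div_pos: "n \<ge> 3 \<Longrightarrow> cos (pi / real n) > 0"
  by (rule cos_gt_zero_pi) (auto simp: field_simps intro: less_trans[of _ 0])

text \<open>Reduced modulo \<open>2 * pi\<close>, an odd multiple of \<open>pi / n\<close> has distance at least \<open>pi / n\<close> from 0. This is what puts
  every vertex of a regular \<open>n\<close>-gon on the inner side of every side line.\<close>

lemma cos_odd_multiple_le:
  assumes n: "n \<ge> 3"
  shows "cos ((2 * of_int i + 1) * pi / real n) \<le> cos (pi / real n)"
proof -
  define r where "r = i mod int n"
  define y where "y = (2 * of_int r + 1) * pi / real n"
  have r: "0 \<le> r" "r \<le> int n - 1" using n by (auto simp: r_def zle_diff1_eq)
  have "i = int n * (i div int n) + r" by (simp add: r_def)
  then have "real_of_int i = real n * of_int (i div int n) + of_int r"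
    by (metis of_int_add of_int_mult of_int_of_nat_eq)
  then have "(2 * of_int i + 1) * pi / real n = y + 2 * pi * of_int (i div int n)"
    using n by (simp add: y_def field_simps)
  then have red: "cos ((2 * of_int i + 1) * pi / real n) = cos y"
    by (simp only: cos_add cos_int_2pin sin_int_2pin)
  have y1: "pi / real n \<le> y" using r n by (simp add: y_def field_simps)
  have "of_int r \<le> real n - 1" using r(2) by linarith
  then have "(2 * of_int r + 1) * pi \<le> (2 * real n - 1) * pi" by (intro mult_right_mono) auto
  then have "y \<le> (2 * real n - 1) * pi / real n" unfolding y_def by (intro divide_right_mono) auto
  also have "\<dots> = 2 * pi - pi / real n" using n by (simp add: field_simps)
  finally have y2: "y \<le> 2 * pi - pi / real n" .
  have n0: "0 \<le> pi / real n" by simp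
  show ?thesis
  proof (cases "y \<le> pi")
    case True
    then show ?thesis unfolding red using y1 n0 by (intro cos_monotone_0_pi_le)
  next
    case False
    have "cos (2 * pi - y) \<le> cos (pi / real n)" using y2 n0 False by (intro cos_monotone_0_pi_le) auto
    then show ?thesis unfolding red by (simp add: cos_diff)
  qed
qed

lemma spoke_sum:
  assumes n: "n \<ge> 3" shows "(\<Sum>k<n. spoke n t k) = 0"
proof -
  have s: "sin (pi / real n) \<noteq> 0" using sin_pi_div_pos[OF n] by simp
  define g where "g = (\<lambda>k. t + (2 * real k - 1) * pi / real n)"
  have gn: "g n = g 0 + 2 * pi" using n by (simp add: g_def field_simps)
  \<comment> \<open>The product formula makes the sum telescope over the angles half way between consecutive spokes.\<close>
  have g_plus: "g (Suc k) = (t + 2 * pi * real k / real n) + pi / real n"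
    and g_minus: "g k = (t + 2 * pi * real k / real n) - pi / real n" for k
    using n by (simp_all add: g_def field_simps)
  have c: "2 * sin (pi / real n) * cos (t + 2 * pi * real k / real n) = sin (g (Suc k)) - sin (g k)" for k
    unfolding g_plus g_minus[of k] sin_add[of _ "pi / real n"] sin_diff[of _ "pi / real n"] by simp
  have "2 * sin (pi / real n) * (\<Sum>k<n. cos (t + 2 * pi * real k / real n)) = 0"
    unfolding sum_distrib_left c by (simp add: sum_lessThan_telescope[of "\<lambda>k. sin (g k)"] gn)
  then have 1: "(\<Sum>k<n. cos (t + 2 * pi * real k / real n)) = 0" using s by simp
  have c': "2 * sin (pi / real n) * sin (t + 2 * pi * real k / real n) = - cos (g (Suc k)) - (- cos (g k))" for k
    unfolding g_plus g_minus[of k] cos_add[of _ "pi / real n"] cos_diff[of _ "pi / real n"] by simp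
  have "2 * sin (pi / real n) * (\<Sum>k<n. sin (t + 2 * pi * real k / real n)) = 0"
    unfolding sum_distrib_left c' by (subst sum_lessThan_telescope[of "\<lambda>k. - cos (g k)"]) (simp add: gn)
  then have 2: "(\<Sum>k<n. sin (t + 2 * pi * real k / real n)) = 0" using s by simp
  show ?thesis using 1 2 by (simp add: vec2_eq_iff spoke_def dir_def)
qed

lemma polar_angle:
  fixes x :: "real^2"
  obtains r \<psi> where "r \<ge> 0" "0 \<le> \<psi>" "\<psi> < 2 * pi" "x = r *\<^sub>R dir (t + \<psi>)"
proof (cases "x = 0")
  case True
  then show ?thesis using that[of 0 0] by simp
next
  case False
  define y where "y = (1 / norm x) *\<^sub>R x"
  define p where "p = y \<bullet> dir t"
  define q where "q = det2 (dir t) y"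
  have p: "p = y$1 * cos t + y$2 * sin t" and q: "q = cos t * y$2 - sin t * y$1"
    by (simp_all add: p_def q_def dir_def inner2 det2_def)
  have "norm y = 1" using False by (simp add: y_def)
  then have "(y$1)\<^sup>2 + (y$2)\<^sup>2 = 1"
    by (simp add: norm_eq_sqrt_inner inner2 power2_eq_square)
  moreover have "p\<^sup>2 + q\<^sup>2 = ((y$1)\<^sup>2 + (y$2)\<^sup>2) * ((cos t)\<^sup>2 + (sin t)\<^sup>2)"
    unfolding p q by algebra
  ultimately have "p\<^sup>2 + q\<^sup>2 = 1" by simp
  then obtain \<psi> where \<psi>: "0 \<le> \<psi>" "\<psi> < 2 * pi" "p = cos \<psi>" "q = sin \<psi>"
    using sincos_total_2pi by blast
  have cs: "y$1 * ((cos t)\<^sup>2 + (sin t)\<^sup>2) = p * cos t - q * sin t"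
    "y$2 * ((cos t)\<^sup>2 + (sin t)\<^sup>2) = p * sin t + q * cos t"
    unfolding p q by algebra+
  then have "y = dir (t + \<psi>)"
    using \<psi>(3,4) by (simp add: vec2_eq_iff dir_def cos_add sin_add algebra_simps)
  then have "x = norm x *\<^sub>R dir (t + \<psi>)" using False by (simp add: y_def flip: \<open>y = dir (t + \<psi>)\<close>)
  then show ?thesis using that \<psi> by (metis norm_ge_zero)
qed

lemma sectors_cover:
  assumes n: "n \<ge> 3"
  shows "\<exists>k<n. det2 (spoke n t k) x \<ge> 0 \<and> det2 x (spoke n t (Suc k)) \<ge> 0"
proof -
  obtain r \<psi> where r: "r \<ge> 0" "0 \<le> \<psi>" "\<psi> < 2 * pi" "x = r *\<^sub>R dir (t + \<psi>)" by (rule polar_angle)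
  define k where "k = nat \<lfloor>\<psi> * real n / (2 * pi)\<rfloor>"
  have f0: "0 \<le> \<psi> * real n / (2 * pi)" using r by simp
  then have k: "real k \<le> \<psi> * real n / (2 * pi)" "\<psi> * real n / (2 * pi) < real k + 1"
    unfolding k_def using f0 by (simp_all add: of_nat_nat)
  have "\<psi> * real n / (2 * pi) < real n" using r n by (simp add: field_simps)
  then have "k < n" using k by linarith
  have le: "2 * pi * real k / real n \<le> \<psi>" "\<psi> \<le> 2 * pi * (real k + 1) / real n"
    using k n by (simp_all add: field_simps)
  have small: "2 * pi / real n \<le> pi" using n by (simp add: field_simps)
  have dist: "2 * pi * (real k + 1) / real n = 2 * pi * real k / real n + 2 * pi / real n"
    using n by (simp add: field_simps)
  have "0 \<le> sin (\<psi> - 2 * pi * real k / real n)"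
    using le small dist by (intro sin_ge_zero) auto
  moreover have "0 \<le> sin (2 * pi * (real k + 1) / real n - \<psi>)"
    using le small dist by (intro sin_ge_zero) auto
  ultimately have "det2 (spoke n t k) x \<ge> 0" "det2 x (spoke n t (Suc k)) \<ge> 0"
    using r(1) by (simp_all add: r(4) spoke_def det2_simps dir_det2 algebra_simps)
  with \<open>k < n\<close> show ?thesis by blast
qed

lemma open_sector_angle:
  assumes n: "n \<ge> 3" and k: "k < n" and r: "r \<ge> 0" "0 \<le> \<psi>" "\<psi> < 2 * pi" "x = r *\<^sub>R dir (t + \<psi>)"
    and pos: "det2 (spoke n t k) x > 0" "det2 x (spoke n t (Suc k)) > 0"
  shows "real k < \<psi> * real n / (2 * pi)" "\<psi> * real n / (2 * pi) < real k + 1"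
proof -
  define A where "A = 2 * pi * real k / real n"
  define d where "d = 2 * pi / real n"
  have d: "0 < d" "d < pi" using n by (auto simp: d_def field_simps)
  have "A + d = 2 * pi * (real k + 1) / real n" using n by (simp add: A_def d_def field_simps)
  moreover have "real k + 1 \<le> real n" using k by linarith
  then have "2 * pi * (real k + 1) / real n \<le> 2 * pi" using n by (simp add: divide_le_eq)
  ultimately have A: "0 \<le> A" "A + d \<le> 2 * pi" by (auto simp: A_def)
  have s1: "sin (\<psi> - A) > 0"
    using pos(1) r(1) by (simp add: r(4) spoke_def det2_simps dir_det2 A_def zero_less_mult_iff)
  have "det2 x (spoke n t (Suc k)) = r * sin (A + d - \<psi>)"
    by (simp add: r(4) spoke_def det2_simps dir_det2 A_def d_def algebra_simps add_divide_distrib)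
  then have s2: "sin (A + d - \<psi>) > 0"
    using pos(2) r(1) by (simp add: zero_less_mult_iff)
  have A\<psi>: "A < \<psi>"
  proof (rule ccontr)
    assume "\<not> A < \<psi>"
    then have le: "\<psi> \<le> A" by simp
    have "\<not> A - \<psi> \<le> pi" using s1 sin_ge_zero[of "A - \<psi>"] le by (auto simp: sin_diff mult.commute)
    then have gt: "A - \<psi> > pi" by simp
    have "sin (A + d - \<psi> - pi) \<ge> 0" using gt A d r by (intro sin_ge_zero) auto
    then show False using s2 by (simp add: sin_diff)
  qed
  have "\<psi> < A + d"
  proof (rule ccontr)
    assume "\<not> \<psi> < A + d"
    then have le: "A + d \<le> \<psi>" by simp
    have "\<not> \<psi> - (A + d) \<le> pi" using s2 sin_ge_zero[of "\<psi> - (A + d)"] le by (auto simp: sin_diff mult.commute)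
    then have gt: "\<psi> - (A + d) > pi" by simp
    have "sin (\<psi> - A - pi) \<ge> 0" using gt A d r by (intro sin_ge_zero) auto
    then show False using s1 by (simp add: sin_diff)
  qed
  with A\<psi> show "real k < \<psi> * real n / (2 * pi)" "\<psi> * real n / (2 * pi) < real k + 1"
    using n by (auto simp: A_def d_def field_simps)
qed

lemma open_sectors_disjoint:
  assumes n: "n \<ge> 3" and jk: "j < n" "k < n"
    and j: "det2 (spoke n t j) x > 0" "det2 x (spoke n t (Suc j)) > 0"
    and k: "det2 (spoke n t k) x > 0" "det2 x (spoke n t (Suc k)) > 0"
  shows "j = k"
proof -
  obtain r \<psi> where r: "r \<ge> 0" "0 \<le> \<psi>" "\<psi> < 2 * pi" "x = r *\<^sub>R dir (t + \<psi>)" by (rule polar_angle)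
  show ?thesis
    using open_sector_angle[OF n jk(1) r j] open_sector_angle[OF n jk(2) r k] by linarith
qed

lemma sector_coordinates:
  assumes "det2 a b > 0" "det2 a x \<ge> 0" "det2 x b \<ge> 0"
  obtains \<alpha> \<beta> where "\<alpha> \<ge> 0" "\<beta> \<ge> 0" "x = \<alpha> *\<^sub>R a + \<beta> *\<^sub>R b"
proof -
  have "det2 a b *\<^sub>R x = det2 x b *\<^sub>R a + det2 a x *\<^sub>R b"
    by (simp add: vec2_eq_iff det2_def algebra_simps)
  then have "x = (det2 x b / det2 a b) *\<^sub>R a + (det2 a x / det2 a b) *\<^sub>R b"
    using assms(1) by (metis (no_types, lifting) divideR_right divide_inverse_commute less_irrefl scaleR_add_right scaleR_scaleR)
  then show ?thesis using that assms by (metis divide_nonneg_pos)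
qed

lemma in_triangle_at_origin:
  assumes "\<alpha> \<ge> 0" "\<beta> \<ge> 0" "\<alpha> + \<beta> \<le> 1"
  shows "\<alpha> *\<^sub>R a + \<beta> *\<^sub>R b \<in> convex hull {0, a, b :: real^2}"
  unfolding convex_hull_3 using assms
  by (intro CollectI exI[of _ "1 - \<alpha> - \<beta>"] exI[of _ \<alpha>] exI[of _ \<beta>]) auto

text \<open>The open sectors are disjoint, so closed ones meet only on lines through \<open>c\<close> along spokes.\<close>

lemma negligible_sector_overlap:
  assumes n: "n \<ge> 3" and jk: "j < n" "k < n" "j \<noteq> k"
    and S: "\<And>x. x \<in> S \<Longrightarrow> det2 (spoke n t j) (x - c) \<ge> 0 \<and> det2 (x - c) (spoke n t (Suc j)) \<ge> 0"
    and T: "\<And>x. x \<in> T \<Longrightarrow> det2 (spoke n t k) (x - c) \<ge> 0 \<and> det2 (x - c) (spoke n t (Suc k)) \<ge> 0"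
  shows "negligible (S \<inter> T)"
proof -
  define L where "L = (\<lambda>i. {x. det2 (spoke n t i) x = det2 (spoke n t i) c})"
  have L: "negligible (L i)" for i
    unfolding L_def by (rule negligible_det2_line) (metis norm_spoke norm_zero zero_neq_one)
  have "S \<inter> T \<subseteq> L j \<union> L (Suc j) \<union> L k \<union> L (Suc k)"
  proof
    fix x assume x: "x \<in> S \<inter> T"
    show "x \<in> L j \<union> L (Suc j) \<union> L k \<union> L (Suc k)"
    proof (rule ccontr)
      assume *: "\<not> ?thesis"
      then have "det2 (spoke n t j) (x - c) > 0" "det2 (spoke n t k) (x - c) > 0"
        "det2 (x - c) (spoke n t (Suc j)) > 0" "det2 (x - c) (spoke n t (Suc k)) > 0"
        using S[of x] T[of x] x
        by (auto simp: L_def det2_diff_right det2_diff_left order_less_le det2_swap[of x] det2_swap[of c])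
      then show False using open_sectors_disjoint[OF n jk(1,2), of t "x - c"] jk(3) by simp
    qed
  qed
  then show ?thesis using L by (meson negligible_Un negligible_subset)
qed

text \<open>Each triangle over a chord is disjoint from its cap, and together they stay in the sector of the chord as
  seen from \<open>c\<close>; different sectors overlap in null sets. For the body \<open>K\<close> the
  centre \<open>c\<close> will be the centroid of the polygons, around which the sectors are equiangular; for its polar it
  will be the origin.\<close>

lemma area_ge_triangles_and_caps:
  assumes n: "n \<ge> 3" and M: "convex M" "M \<in> lmeasurable" "c \<in> M"
    and p: "\<And>k. k \<le> n \<Longrightarrow> p k \<in> M"
    and p_spoke: "\<And>k. k \<le> n \<Longrightarrow> \<exists>\<rho>>0. p k = c + \<rho> *\<^sub>R spoke n t k"
    and cap: "\<And>k x. k < n \<Longrightarrow> x \<in> cap M (p k) (p (Suc k)) \<Longrightarrow>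
      det2 (p k - c) (x - c) \<ge> 0 \<and> det2 (x - c) (p (Suc k) - c) \<ge> 0"
  shows "(\<Sum>k<n. det2 (p k - c) (p (Suc k) - c) + 2 * area (cap M (p k) (p (Suc k)))) \<le> 2 * area M"
proof -
  define T where "T = (\<lambda>k. convex hull {c, p k, p (Suc k)})"
  define C where "C = (\<lambda>k. cap M (p k) (p (Suc k)))"
  have det: "det2 (p k - c) (p (Suc k) - c) > 0" if k: "k < n" for k
  proof -
    obtain \<rho> \<rho>' where "\<rho> > 0" "p k = c + \<rho> *\<^sub>R spoke n t k" "\<rho>' > 0" "p (Suc k) = c + \<rho>' *\<^sub>R spoke n t (Suc k)"
      using p_spoke[of k] p_spoke[of "Suc k"] k by auto
    then show ?thesis using sin_2pi_div_pos[OF n] by (simp add: det2_simps spoke_Suc_det2)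
  qed
  have CM: "C k \<in> lmeasurable" "C k \<subseteq> M" for k
    using M cap_lmeasurable cap_subset by (auto simp: C_def)
  have TM: "T k \<in> lmeasurable" "k < n \<Longrightarrow> T k \<subseteq> M" for k
    unfolding T_def using M p[of k] p[of "Suc k"] by (simp, intro hull_minimal) auto
  have area: "2 * area (T k \<union> C k) = det2 (p k - c) (p (Suc k) - c) + 2 * area (C k)" if k: "k < n" for k
  proof -
    have "convex {x. det2 (p k - p (Suc k)) x \<le> det2 (p k) (p (Suc k))}"
      using convex_halfspace_le[of "perp (p k - p (Suc k))"] by (simp add: perp_inner)
    then have "T k \<subseteq> {x. det2 (p k - p (Suc k)) x \<le> det2 (p k) (p (Suc k))}"
      unfolding T_def using det[OF k]
      by (intro hull_minimal) (auto simp: det2_simps det2_swap[of "p (Suc k)" "p k"] det2_swap[of _ c])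
    then have "T k \<inter> C k = {}" by (force simp: C_def cap_def)
    then have "area (T k \<union> C k) = area (T k) + area (C k)"
      unfolding area_def using TM(1) CM(1) by (intro measure_Un2[THEN trans]) (auto simp: Diff_triv Int_commute fmeasurableD)
    then show ?thesis using det[OF k] by (simp add: T_def area_triangle)
  qed
  have inc: "det2 (spoke n t k) (x - c) \<ge> 0 \<and> det2 (x - c) (spoke n t (Suc k)) \<ge> 0"
    if k: "k < n" and x: "x \<in> T k \<union> C k" for k x
  proof -
    obtain \<rho> \<rho>' where \<rho>: "\<rho> > 0" "p k = c + \<rho> *\<^sub>R spoke n t k" "\<rho>' > 0" "p (Suc k) = c + \<rho>' *\<^sub>R spoke n t (Suc k)"
      using p_spoke[of k] p_spoke[of "Suc k"] k by auto
    have "det2 (p k - c) (x - c) \<ge> 0 \<and> det2 (x - c) (p (Suc k) - c) \<ge> 0"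
    proof (cases "x \<in> C k")
      case True
      then show ?thesis using cap[OF k] by (simp add: C_def)
    next
      case False
      have "T k \<subseteq> {x. det2 (p k - c) x \<ge> det2 (p k - c) c} \<inter> {x. det2 x (p (Suc k) - c) \<ge> det2 c (p (Suc k) - c)}"
        unfolding T_def using det[OF k]
        by (intro hull_minimal convex_Int convex_det2_ge convex_det2_ge_left)
          (auto simp: det2_simps det2_swap[of _ c])
      then show ?thesis using False x by (auto simp: det2_simps)
    qed
    then show ?thesis using \<rho> by (simp add: det2_simps zero_le_mult_iff flip: right_diff_distrib)
  qed
  have "(\<Sum>k<n. area (T k \<union> C k)) = measure lebesgue (\<Union>k<n. T k \<union> C k)"
    unfolding area_def
  proof (rule measure_negligible_finite_Union_image[symmetric])
    show "pairwise (\<lambda>j k. negligible ((T j \<union> C j) \<inter> (T k \<union> C k))) {..<n}"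
    proof (rule pairwiseI)
      fix j k assume jk: "j \<in> {..<n}" "k \<in> {..<n}" "j \<noteq> k"
      show "negligible ((T j \<union> C j) \<inter> (T k \<union> C k))"
        by (rule negligible_sector_overlap[OF n, of j k _ t c]) (use jk inc in auto)
    qed
  qed (use TM CM in \<open>auto intro: fmeasurable.Un\<close>)
  also have "\<dots> \<le> area M"
    unfolding area_def using M(2) TM CM(1) subsetD[OF CM(2)]
    by (intro measure_mono_fmeasurable) (auto simp: fmeasurableD intro!: sets.finite_UN sets.Un)
  finally have "(\<Sum>k<n. 2 * area (T k \<union> C k)) \<le> 2 * area M" by (simp flip: sum_distrib_left)
  then show ?thesis using area by (simp add: C_def)
qed

text \<open>The \<open>n\<close> half-planes cut out the regular \<open>n\<close>-gon with inradius \<open>d\<close>. Its triangles over the sectors centred at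
  the normals \<open>spoke n t k\<close> cover \<open>M\<close>.\<close>

lemma area_le_circumscribed:
  assumes n: "n \<ge> 3" and d: "d > 0" and M: "M \<in> lmeasurable"
    and le: "\<And>x k. x \<in> M \<Longrightarrow> k < n \<Longrightarrow> x \<bullet> spoke n t k \<le> d"
  shows "area M \<le> real n * d\<^sup>2 * tan (pi / real n)"
proof -
  define c where "c = cos (pi / real n)"
  have c: "c > 0" using cos_pi_div_pos[OF n] by (simp add: c_def)
  define e where "e = (\<lambda>k. (d / c) *\<^sub>R spoke n (t - pi / real n) k)"
  have dete: "det2 (e k) (e (Suc k)) = (d / c)\<^sup>2 * sin (2 * pi / real n)" for k
    by (simp add: e_def det2_simps spoke_Suc_det2 power2_eq_square)
  have pos: "(d / c)\<^sup>2 * sin (2 * pi / real n) > 0" using d c sin_2pi_div_pos[OF n] by simp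
  have e1: "e k \<bullet> spoke n t k = d" "e (Suc k) \<bullet> spoke n t k = d" for k
    using c by (simp_all add: e_def spoke_inner c_def)
  have "M \<subseteq> (\<Union>k<n. convex hull {0, e k, e (Suc k)})"
  proof
    fix x assume x: "x \<in> M"
    obtain k where k: "k < n" "det2 (spoke n (t - pi / real n) k) x \<ge> 0" "det2 x (spoke n (t - pi / real n) (Suc k)) \<ge> 0"
      using sectors_cover[OF n] by blast
    then have "det2 (e k) x \<ge> 0" "det2 x (e (Suc k)) \<ge> 0" using d c by (auto simp: e_def det2_simps)
    then obtain \<alpha> \<beta> where ab: "\<alpha> \<ge> 0" "\<beta> \<ge> 0" "x = \<alpha> *\<^sub>R e k + \<beta> *\<^sub>R e (Suc k)"
      using sector_coordinates[of "e k" "e (Suc k)" x] dete pos by metis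
    have "x \<bullet> spoke n t k \<le> d" using le x k by simp
    then have "(\<alpha> + \<beta>) * d \<le> d" by (simp add: ab(3) inner_add_left e1 algebra_simps)
    then have "\<alpha> + \<beta> \<le> 1" using d by simp
    then show "x \<in> (\<Union>k<n. convex hull {0, e k, e (Suc k)})"
      using in_triangle_at_origin[OF ab(1,2)] ab(3) k(1) by blast
  qed
  then have "area M \<le> area (\<Union>k<n. convex hull {0, e k, e (Suc k)})"
    using M by (intro area_mono fmeasurable.finite_UN) auto
  also have "\<dots> \<le> (\<Sum>k<n. area (convex hull {0, e k, e (Suc k)}))"
    unfolding area_def by (intro measure_UNION_le) (auto simp: fmeasurableD)
  also have "\<dots> = (\<Sum>k<n. (d / c)\<^sup>2 * sin (2 * pi / real n) / 2)"
    using pos by (simp add: area_triangle dete)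
  also have "\<dots> = real n * ((d / c)\<^sup>2 * (2 * sin (pi / real n) * c) / 2)"
    using sin_double[of "pi / real n"] by (simp add: c_def)
  also have "\<dots> = real n * d\<^sup>2 * tan (pi / real n)"
    using c by (simp add: tan_def power2_eq_square c_def[symmetric])
  finally show ?thesis .
qed

section \<open>Regular polygons\<close>

definition ngon :: "nat \<Rightarrow> real^2 \<Rightarrow> real \<Rightarrow> real \<Rightarrow> (real^2) set" where
  "ngon n c r t = convex hull ((\<lambda>k. c + r *\<^sub>R spoke n t k) ` {..<n})"

lemma regular_ngon_iff: "regular_ngon n P \<longleftrightarrow> (\<exists>c r t. r > 0 \<and> P = ngon n c r t)"
  by (simp add: regular_ngon_def ngon_def spoke_def dir_def)

lemma compact_ngon: "compact (ngon n c r t)"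
  by (simp add: ngon_def finite_imp_compact_convex_hull)

lemma convex_ngon: "convex (ngon n c r t)"
  by (simp add: ngon_def)

lemma ngon_vertex: "k < n \<Longrightarrow> c + r *\<^sub>R spoke n t k \<in> ngon n c r t"
  unfolding ngon_def by (intro hull_inc) auto

lemma ngon_vertex_le: "n > 0 \<Longrightarrow> k \<le> n \<Longrightarrow> c + r *\<^sub>R spoke n t k \<in> ngon n c r t"
  using ngon_vertex[of k n] ngon_vertex[of 0 n] spoke_last[of n t] by (cases "k = n") auto

lemma ngon_side_le:
  assumes n: "n \<ge> 3" and r: "r > 0" and x: "x \<in> ngon n c r t"
  shows "(x - c) \<bullet> spoke n (t + pi / real n) k \<le> r * cos (pi / real n)"
proof -
  let ?m = "spoke n (t + pi / real n) k"
  have "spoke n t j \<bullet> ?m \<le> cos (pi / real n)" for j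
  proof -
    have "spoke n t j \<bullet> ?m = cos ((2 * of_int (int k - int j) + 1) * pi / real n)"
      unfolding spoke_inner by (subst cos_minus[symmetric], rule arg_cong[of _ _ cos])
        (use n in \<open>simp add: field_simps\<close>)
    then show ?thesis using cos_odd_multiple_le[OF n] by metis
  qed
  then have "ngon n c r t \<subseteq> {x. ?m \<bullet> x \<le> r * cos (pi / real n) + ?m \<bullet> c}"
    unfolding ngon_def using r
    by (intro hull_minimal convex_halfspace_le) (auto simp: inner_add_left inner_commute[of ?m])
  then show ?thesis using x by (auto simp: inner_diff_left inner_commute[of ?m])
qed

text \<open>Inside the sector of two neighbouring vertices the single inequality of the side between them already
  forces \<open>x\<close> into the triangle spanned by the centre and these vertices.\<close>

lemma ngonI:
  assumes n: "n \<ge> 3" and r: "r > 0"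
    and x: "\<And>k. k < n \<Longrightarrow> (x - c) \<bullet> spoke n (t + pi / real n) k \<le> r * cos (pi / real n)"
  shows "x \<in> ngon n c r t"
proof -
  obtain k where k: "k < n" "det2 (spoke n t k) (x - c) \<ge> 0" "det2 (x - c) (spoke n t (Suc k)) \<ge> 0"
    using sectors_cover[OF n] by blast
  then obtain \<alpha> \<beta> where ab: "\<alpha> \<ge> 0" "\<beta> \<ge> 0" "x - c = \<alpha> *\<^sub>R spoke n t k + \<beta> *\<^sub>R spoke n t (Suc k)"
    using sector_coordinates[of "spoke n t k" "spoke n t (Suc k)" "x - c"]
      spoke_Suc_det2[of n t k] sin_2pi_div_pos[OF n] by metis
  have "(x - c) \<bullet> spoke n (t + pi / real n) k = (\<alpha> + \<beta>) * cos (pi / real n)"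
    by (simp add: ab(3) inner_add_left spoke_inner algebra_simps)
  then have sum: "\<alpha> + \<beta> \<le> r" using x[OF k(1)] cos_pi_div_pos[OF n] by simp
  have center: "c \<in> ngon n c r t"
  proof -
    have "(\<Sum>k<n. (1 / real n) *\<^sub>R (c + r *\<^sub>R spoke n t k)) \<in> ngon n c r t"
      by (intro convex_sum convex_ngon ngon_vertex) (use n in auto)
    also have "(\<Sum>k<n. (1 / real n) *\<^sub>R (c + r *\<^sub>R spoke n t k)) = c"
      using n by (simp add: scaleR_right.sum[symmetric] sum.distrib spoke_sum
          sum_constant_scaleR del: sum_constant)
    finally show ?thesis .
  qed
  have "(1 - \<alpha> / r - \<beta> / r) *\<^sub>R c + (\<alpha> / r) *\<^sub>R (c + r *\<^sub>R spoke n t k) +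
      (\<beta> / r) *\<^sub>R (c + r *\<^sub>R spoke n t (Suc k)) \<in> ngon n c r t"
  proof -
    have "convex hull {c, c + r *\<^sub>R spoke n t k, c + r *\<^sub>R spoke n t (Suc k)} \<subseteq> ngon n c r t"
      using center ngon_vertex_le[of n k] ngon_vertex_le[of n "Suc k"] k n
      by (intro hull_minimal convex_ngon) auto
    moreover have "1 - \<alpha> / r - \<beta> / r \<ge> 0" using sum r
      by (simp add: diff_diff_eq flip: add_divide_distrib)
    ultimately show ?thesis unfolding convex_hull_3 using ab r by fastforce
  qed
  also have "(1 - \<alpha> / r - \<beta> / r) *\<^sub>R c + (\<alpha> / r) *\<^sub>R (c + r *\<^sub>R spoke n t k) +
      (\<beta> / r) *\<^sub>R (c + r *\<^sub>R spoke n t (Suc k)) = x"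
  proof -
    have "x = c + (\<alpha> *\<^sub>R spoke n t k + \<beta> *\<^sub>R spoke n t (Suc k))" using ab(3) by (simp add: algebra_simps)
    then show ?thesis using r by (simp add: algebra_simps)
  qed
  finally show ?thesis .
qed

lemma ngon_interiorI:
  assumes n: "n \<ge> 3" and r: "r > 0"
    and x: "\<And>k. k < n \<Longrightarrow> (x - c) \<bullet> spoke n (t + pi / real n) k < r * cos (pi / real n)"
  shows "x \<in> interior (ngon n c r t)"
proof -
  let ?U = "\<Inter>k<n. {x. (x - c) \<bullet> spoke n (t + pi / real n) k < r * cos (pi / real n)}"
  have "open ?U" by (intro open_INT ballI open_Collect_less continuous_intros) auto
  moreover have "?U \<subseteq> ngon n c r t"
    by (intro subsetI ngonI[OF n r]) (auto intro: less_imp_le)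
  ultimately show ?thesis using x by (intro interiorI[of ?U]) auto
qed

lemma ngon_center_interior:
  assumes n: "n \<ge> 3" and r: "r > 0" shows "c \<in> interior (ngon n c r t)"
  by (rule ngon_interiorI[OF n r]) (use cos_pi_div_pos[OF n] r in auto)

lemma ngon_vertex_extreme:
  assumes n: "n \<ge> 3" and r: "r > 0"
  shows "(c + r *\<^sub>R spoke n t 0) extreme_point_of (ngon n c r t)"
proof -
  have sub: "ngon n c r t \<subseteq> cball c r"
    unfolding ngon_def using r by (intro hull_minimal convex_cball) (auto simp: dist_norm)
  have d: "dist c (c + r *\<^sub>R spoke n t 0) = r" using r by (simp add: dist_norm)
  have "c + r *\<^sub>R spoke n t 0 \<notin> open_segment a b" if "a \<in> ngon n c r t" "b \<in> ngon n c r t" for a b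
  proof -
    have "dist c a \<le> r" "dist c b \<le> r" using that sub by auto
    then show ?thesis using dist_decreases_open_segment[of "c + r *\<^sub>R spoke n t 0" a b c] d by auto
  qed
  then show ?thesis using ngon_vertex[of 0 n] n by (auto simp: extreme_point_of_def)
qed

text \<open>A proper face contains no interior point, so one of the side inequalities is attained.\<close>

lemma vertex_on_side:
  assumes n: "n \<ge> 3" and r: "r > 0" and S: "S edge_of (ngon n c r t)" and v: "v \<in> S"
  obtains j where "j < n" "(v - c) \<bullet> spoke n (t + pi / real n) j = r * cos (pi / real n)"
proof -
  let ?P = "ngon n c r t"
  have "aff_dim ?P = 2"
    using ngon_center_interior[OF n r] aff_dim_nonempty_interior[of ?P] by auto
  then have "S \<noteq> ?P" using S by (auto simp: edge_of_def)
  then have "v \<notin> interior ?P" using face_of_disjoint_interior[of S ?P] S v by (auto simp: edge_of_def)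
  then obtain j where j: "j < n" "\<not> (v - c) \<bullet> spoke n (t + pi / real n) j < r * cos (pi / real n)"
    using ngon_interiorI[OF n r] by blast
  moreover have "v \<in> ?P" using S v edge_of_imp_subset by blast
  ultimately have "(v - c) \<bullet> spoke n (t + pi / real n) j = r * cos (pi / real n)"
    using ngon_side_le[OF n r, of v c t j] by simp
  then show ?thesis using that j(1) by blast
qed

definition rot :: "real \<Rightarrow> real^2 \<Rightarrow> real^2" where
  "rot \<theta> x = vector [cos \<theta> * x$1 - sin \<theta> * x$2, sin \<theta> * x$1 + cos \<theta> * x$2]"

lemma linear_rot: "linear (rot \<theta>)"
  by (rule linearI) (simp_all add: rot_def vec2_eq_iff algebra_simps)

lemma rot_spoke: "n > 0 \<Longrightarrow> rot (2 * pi / real n) (spoke n t k) = spoke n t (Suc k)"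
  by (simp add: rot_def spoke_def dir_def add_divide_distrib distrib_left cos_add sin_add vec2_eq_iff algebra_simps)

lemma det_rot: "det (matrix (rot \<theta>)) = 1"
  using sin_cos_squared_add3[of \<theta>]
  by (simp add: det_2 matrix_def rot_def axis_def)

lemma rot_eq_self:
  assumes "rot \<theta> x = x" "cos \<theta> \<noteq> 1" shows "x = 0"
proof -
  have 1: "cos \<theta> * x$1 - sin \<theta> * x$2 = x$1" "sin \<theta> * x$1 + cos \<theta> * x$2 = x$2"
    using assms(1) by (simp_all add: rot_def vec2_eq_iff)
  define C where "C = 1 - cos \<theta>"
  define S where "S = sin \<theta>"
  have 2: "C * x$1 = - (S * x$2)" "C * x$2 = S * x$1"
    using 1 by (simp_all add: C_def S_def algebra_simps)
  have "(C\<^sup>2 + S\<^sup>2) * x$1 = C * (C * x$1) + S * (S * x$1)"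
    "(C\<^sup>2 + S\<^sup>2) * x$2 = C * (C * x$2) + S * (S * x$2)"
    by (simp_all add: power2_eq_square algebra_simps)
  moreover have "C * (C * x$1) = - (S * (S * x$1))" "C * (C * x$2) = - (S * (S * x$2))"
    using 2 by (metis mult.left_commute mult_minus_right)+
  moreover have "C\<^sup>2 + S\<^sup>2 > 0" using assms(2) by (intro add_pos_nonneg) (auto simp: C_def)
  ultimately show ?thesis by (auto simp: vec2_eq_iff)
qed

lemma rot_ngon:
  assumes n: "n \<ge> 3"
  shows "(\<lambda>x. c + rot (2 * pi / real n) (x - c)) ` ngon n c r t = ngon n c r t"
proof -
  let ?rot = "rot (2 * pi / real n)"
  let ?V = "(\<lambda>k. c + r *\<^sub>R spoke n t k) ` {..<n}"
  have g: "(\<lambda>x. c + ?rot (x - c)) = (\<lambda>x. (c - ?rot c) + ?rot x)"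
    by (simp add: linear_diff[OF linear_rot] algebra_simps)
  have gV: "c + ?rot (c + r *\<^sub>R spoke n t k - c) = c + r *\<^sub>R spoke n t (Suc k)" for k
    using n by (simp add: linear_scale[OF linear_rot] rot_spoke)
  have "(\<lambda>x. c + ?rot (x - c)) ` ?V = (\<lambda>k. c + r *\<^sub>R spoke n t (Suc k)) ` {..<n}"
    unfolding image_image gV ..
  also have "\<dots> = (\<lambda>k. c + r *\<^sub>R spoke n t k) ` (Suc ` {..<n})" by (simp add: image_image)
  also have "Suc ` {..<n} = {1..<n} \<union> {n}" using n
    by (auto simp: image_Suc_lessThan)
  also have "(\<lambda>k. c + r *\<^sub>R spoke n t k) ` ({1..<n} \<union> {n}) = (\<lambda>k. c + r *\<^sub>R spoke n t k) ` ({1..<n} \<union> {0})"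
    using n by (simp only: image_Un image_insert image_empty) (simp add: spoke_last)
  also have "{1..<n} \<union> {0} = {..<n}" using n by auto
  finally have V: "(\<lambda>x. c + ?rot (x - c)) ` ?V = ?V" .
  have "(\<lambda>x. c + ?rot (x - c)) ` (convex hull ?V) = convex hull ((\<lambda>x. c + ?rot (x - c)) ` ?V)"
    unfolding g image_image[symmetric, of "\<lambda>x. (c - ?rot c) + x" ?rot]
    by (simp only: convex_hull_translation convex_hull_linear_image[OF linear_rot])
  then show ?thesis unfolding ngon_def V .
qed

text \<open>The polygon is invariant under the rotation by \<open>2 * pi / n\<close> about \<open>c\<close>, hence the integral of \<open>x - c\<close> is a fixed
  vector of a nontrivial rotation and vanishes.\<close>

lemma centroid_ngon:
  assumes n: "n \<ge> 3" and r: "r > 0" shows "centroid (ngon n c r t) = c"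
proof -
  let ?P = "ngon n c r t"
  let ?\<theta> = "2 * pi / real n"
  define g where "g = (\<lambda>x. c + rot ?\<theta> (x - c))"
  have Pm: "?P \<in> lmeasurable" by (simp add: compact_ngon lmeasurable_compact)
  have abs: "(\<lambda>x. x - c) absolutely_integrable_on ?P"
    using borel_integrable_compact[OF compact_ngon, of n c r t "\<lambda>x. x - c"]
    by (simp add: set_integrable_def integrable_completion continuous_intros)
  then have int: "(\<lambda>x. x - c) integrable_on ?P" using set_lebesgue_integral_eq_integral(1) by blast
  have bl: "bounded_linear (rot ?\<theta>)" using linear_rot linear_conv_bounded_linear by blast
  have der: "(g has_derivative rot ?\<theta>) (at x within S)" for x S
  proof -
    have "((\<lambda>x. x - c) has_derivative (\<lambda>x. x)) (at x within S)" by (auto intro!: derivative_eq_intros)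
    from bounded_linear.has_derivative[OF bl this] show ?thesis
      unfolding g_def by (auto intro!: derivative_eq_intros)
  qed
  have "inj (rot ?\<theta>)"
    using det_nz_iff_inj[OF linear_rot] det_rot by (metis zero_neq_one)
  have inj: "inj_on g ?P"
  proof (rule inj_onI)
    fix x y assume "g x = g y"
    then have "rot ?\<theta> (x - c) = rot ?\<theta> (y - c)" by (simp add: g_def)
    then have "x - c = y - c" by (rule injD[OF \<open>inj (rot ?\<theta>)\<close>])
    then show "x = y" by simp
  qed
  have gP: "g ` ?P = ?P" unfolding g_def by (rule rot_ngon[OF n])
  have "integral (g ` ?P) (\<lambda>x. x - c) = integral ?P (\<lambda>x. \<bar>det (matrix (rot ?\<theta>))\<bar> *\<^sub>R (g x - c))"
    by (rule integral_change_of_variables[OF _ der inj]) (use Pm abs gP in \<open>auto simp: fmeasurableD\<close>)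
  also have "\<dots> = integral ?P (rot ?\<theta> \<circ> (\<lambda>x. x - c))" by (simp add: det_rot g_def o_def)
  also have "\<dots> = rot ?\<theta> (integral ?P (\<lambda>x. x - c))" by (rule integral_linear[OF int bl])
  finally have "rot ?\<theta> (integral ?P (\<lambda>x. x - c)) = integral ?P (\<lambda>x. x - c)" by (simp add: gP)
  moreover have "cos ?\<theta> \<noteq> 1"
  proof
    assume "cos ?\<theta> = 1"
    then have "(sin ?\<theta>)\<^sup>2 = 0" by (simp only: sin_squared_eq) simp
    then show False using sin_2pi_div_pos[OF n] by simp
  qed
  ultimately have zero: "integral ?P (\<lambda>x. x - c) = 0" by (rule rot_eq_self)
  have const: "integral ?P (\<lambda>x. c) = area ?P *\<^sub>R c"
  proof -
    have "(\<lambda>x. 1::real) integrable_on ?P" using Pm by (rule integrable_on_const)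
    from integral_linear[OF this bounded_linear_scaleR_left[of c]]
    show ?thesis by (simp add: o_def area_def lmeasure_integral[OF Pm])
  qed
  have "integral ?P (\<lambda>x. x) = integral ?P (\<lambda>x. (x - c) + c)" by simp
  also have "\<dots> = area ?P *\<^sub>R c"
    using integral_add[OF int integrable_on_const[OF Pm, of c]] zero const by simp
  finally have I: "integral ?P (\<lambda>x. x) = area ?P *\<^sub>R c" .
  have "\<not> negligible ?P"
    using ngon_center_interior[OF n r] negligible_convex_interior[OF convex_ngon] by blast
  then have "area ?P \<noteq> 0" using Pm by (simp add: area_def negligible_iff_measure)
  then show ?thesis by (simp add: centroid_def I)
qed

text \<open>The polygon has inradius \<open>r * cos (pi / n)\<close>, and its vertices bound its polar by half-planes at distance \<open>1 / r\<close>;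
  both areas are estimated by \<open>area_le_circumscribed\<close>.\<close>

lemma ngon_volume_product_le:
  assumes n: "n \<ge> 3" and r: "r > 0"
  shows "area (ngon n 0 r t) * area (polar (ngon n 0 r t)) \<le> (real n)\<^sup>2 * (sin (pi / real n))\<^sup>2"
proof -
  let ?P = "ngon n 0 r t"
  have c: "cos (pi / real n) > 0" by (rule cos_pi_div_pos[OF n])
  have 1: "area ?P \<le> real n * (r * cos (pi / real n))\<^sup>2 * tan (pi / real n)"
    using ngon_side_le[OF n r, of _ 0 t] r c compact_ngon
    by (intro area_le_circumscribed[OF n, of _ _ "t + pi / real n"]) (auto simp: lmeasurable_compact)
  have "y \<bullet> spoke n t k \<le> 1 / r" if "y \<in> polar ?P" "k < n" for y k
    using polarD[OF that(1) ngon_vertex[OF that(2)]] r by (simp add: field_simps)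
  then have 2: "area (polar ?P) \<le> real n * (1 / r)\<^sup>2 * tan (pi / real n)"
    using r ngon_center_interior[OF n r, of 0 t]
    by (intro area_le_circumscribed[OF n, of _ _ t]) (auto simp: lmeasurable_compact compact_polar)
  have "area ?P * area (polar ?P) \<le> (real n * (r * cos (pi / real n))\<^sup>2 * tan (pi / real n)) * (real n * (1 / r)\<^sup>2 * tan (pi / real n))"
    using 1 2 by (intro mult_mono) (auto simp: area_def intro: order_trans[OF measure_nonneg])
  also have "\<dots> = (real n)\<^sup>2 * (sin (pi / real n))\<^sup>2"
    using r c by (simp add: tan_def power2_eq_square field_simps)
  finally show ?thesis .
qed

section \<open>A weighted Cauchy-Schwarz inequality\<close>

text \<open>Normalise so that the sums of \<open>A\<close> and of \<open>B\<close> are 1. Then \<open>A k + B k \<ge> 2 * sqrt (A k * B k)\<close>, and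
  \<open>2 / sqrt m\<close> is bounded below by its tangent \<open>3 - m\<close> at \<open>m = 1\<close>; summation gives the inequality. Equality forces
  all weights to be 1 and both sequences to be constant.\<close>

lemma weighted_cauchy_schwarz:
  fixes A B m :: "nat \<Rightarrow> real"
  assumes n: "n > 0" and s: "s > 0"
    and pos: "\<And>k. k < n \<Longrightarrow> A k > 0" "\<And>k. k < n \<Longrightarrow> B k > 0" "\<And>k. k < n \<Longrightarrow> m k > 0"
    and m: "(\<Sum>k<n. m k) = real n" and AB: "\<And>k. k < n \<Longrightarrow> s\<^sup>2 \<le> A k * B k * m k"
  shows "(real n * s)\<^sup>2 \<le> sum A {..<n} * sum B {..<n}"
    and "sum A {..<n} * sum B {..<n} = (real n * s)\<^sup>2 \<Longrightarrow> k < n \<Longrightarrow>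
      m k = 1 \<and> A k = sum A {..<n} / real n \<and> B k = sum B {..<n} / real n"
proof -
  define X where "X = sum A {..<n}"
  define Y where "Y = sum B {..<n}"
  have X: "X > 0" and Y: "Y > 0" unfolding X_def Y_def using n pos by (auto intro!: sum_pos)
  define \<rho> where "\<rho> = s / sqrt (X * Y)"
  have \<rho>: "\<rho> > 0" using s X Y by (simp add: \<rho>_def)
  have \<rho>2: "\<rho>\<^sup>2 = s\<^sup>2 / (X * Y)" using X Y by (simp add: \<rho>_def power_divide)
  define w where "w = (\<lambda>k. A k / X + B k / Y)"
  have prod: "\<rho>\<^sup>2 \<le> (A k / X) * (B k / Y) * m k" if "k < n" for k
    using AB[OF that] X Y by (simp add: \<rho>2 divide_right_mono)
  have w2: "4 * \<rho>\<^sup>2 \<le> (w k)\<^sup>2 * m k" if "k < n" for k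
  proof -
    have "4 * ((A k / X) * (B k / Y)) \<le> (w k)\<^sup>2"
    proof -
      have "(w k)\<^sup>2 = 4 * ((A k / X) * (B k / Y)) + (A k / X - B k / Y)\<^sup>2"
        unfolding w_def by algebra
      then show ?thesis by simp
    qed
    then have "4 * ((A k / X) * (B k / Y)) * m k \<le> (w k)\<^sup>2 * m k"
      using pos(3)[OF that] by (intro mult_right_mono) auto
    then show ?thesis using prod[OF that] by simp
  qed
  \<comment> \<open>Equivalent to \<open>4 - (3 - m)\<^sup>2 * m = (1 - m)\<^sup>2 * (4 - m)\<close> being nonnegative for \<open>m \<le> 3\<close>.\<close>
  have tangent: "\<rho> * (3 - m k) \<le> w k" if k: "k < n" for k
  proof (rule ccontr)
    assume "\<not> ?thesis"
    then have lt: "w k < \<rho> * (3 - m k)" by simp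
    have w0: "0 < w k" using pos[OF k] X Y by (simp add: w_def add_pos_pos)
    then have "0 < \<rho> * (3 - m k)" using lt by simp
    then have m3: "m k < 3" using \<rho> by (simp add: zero_less_mult_iff)
    have "(w k)\<^sup>2 < (\<rho> * (3 - m k))\<^sup>2" using lt w0 by (intro power_strict_mono) auto
    then have "(w k)\<^sup>2 * m k < (\<rho> * (3 - m k))\<^sup>2 * m k" using pos(3)[OF k] by simp
    then have "4 * \<rho>\<^sup>2 < \<rho>\<^sup>2 * ((3 - m k)\<^sup>2 * m k)" using w2[OF k] by (simp add: power_mult_distrib mult.assoc)
    then have "4 < (3 - m k)\<^sup>2 * m k" using \<rho> by simp
    moreover have "4 - (3 - m k)\<^sup>2 * m k = (1 - m k)\<^sup>2 * (4 - m k)"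
      by (simp add: power2_eq_square algebra_simps)
    ultimately show False using m3 by (smt (verit) zero_le_power2 mult_nonneg_nonneg)
  qed
  have sumw: "(\<Sum>k<n. w k) = 2"
    using X Y by (simp add: w_def sum.distrib sum_divide_distrib[symmetric] X_def[symmetric] Y_def[symmetric])
  have sum\<rho>: "(\<Sum>k<n. \<rho> * (3 - m k)) = 2 * real n * \<rho>"
    using m by (simp add: sum_distrib_left[symmetric] sum_subtractf)
  have "2 * real n * \<rho> \<le> 2" using sum_mono[of "{..<n}" "\<lambda>k. \<rho> * (3 - m k)" w] tangent sumw sum\<rho> by simp
  then have "(real n * \<rho>)\<^sup>2 \<le> 1\<^sup>2" using \<rho> by (intro power_mono) auto
  then show "(real n * s)\<^sup>2 \<le> sum A {..<n} * sum B {..<n}"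
    using X Y by (simp add: power_mult_distrib \<rho>2 X_def[symmetric] Y_def[symmetric] field_simps)
  assume eq: "sum A {..<n} * sum B {..<n} = (real n * s)\<^sup>2" and k: "k < n"
  have "sqrt (X * Y) = real n * s"
    unfolding X_def Y_def eq using s by simp
  then have \<rho>n: "\<rho> = 1 / real n" using s by (simp add: \<rho>_def)
  have "(\<Sum>k<n. w k - \<rho> * (3 - m k)) = 0" using n
    unfolding sum_subtractf sumw sum\<rho> by (simp add: \<rho>n)
  then have "w k - \<rho> * (3 - m k) = 0"
    using k tangent by (subst (asm) sum_nonneg_eq_0_iff) auto
  then have wk: "w k = \<rho> * (3 - m k)" by simp
  have "0 < w k" using pos[OF k] X Y by (simp add: w_def add_pos_pos)
  then have m3: "m k < 3" using \<rho> by (simp add: wk zero_less_mult_iff)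
  have "4 * \<rho>\<^sup>2 \<le> \<rho>\<^sup>2 * ((3 - m k)\<^sup>2 * m k)" using w2[OF k] by (simp add: wk power_mult_distrib mult.assoc)
  then have "4 \<le> (3 - m k)\<^sup>2 * m k" using \<rho> by simp
  moreover have "4 - (3 - m k)\<^sup>2 * m k = (1 - m k)\<^sup>2 * (4 - m k)"
    by (simp add: power2_eq_square algebra_simps)
  ultimately have "(1 - m k)\<^sup>2 * (4 - m k) \<le> 0" by linarith
  then have "(1 - m k)\<^sup>2 \<le> 0" using m3 by (simp add: mult_le_0_iff)
  then have m1: "m k = 1" by simp
  have ab: "A k / X + B k / Y = 2 * \<rho>" using wk m1 by (simp add: w_def)
  have "(A k / X - B k / Y)\<^sup>2 = (A k / X + B k / Y)\<^sup>2 - 4 * ((A k / X) * (B k / Y))"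
    by (simp add: power2_eq_square algebra_simps)
  also have "\<dots> \<le> 0" using prod[OF k] m1 by (simp only: ab) (simp add: power_mult_distrib)
  finally have "A k / X = B k / Y" by simp
  then have "A k / X = 1 / real n" "B k / Y = 1 / real n" using ab \<rho>n by simp_all
  then show "m k = 1 \<and> A k = sum A {..<n} / real n \<and> B k = sum B {..<n} / real n"
    using m1 X Y by (simp add: X_def[symmetric] Y_def[symmetric] field_simps)
qed

section \<open>Bodies between two regular polygons\<close>

text \<open>Here \<open>f\<close> and \<open>g\<close> are normals of lines supporting the body at \<open>a\<close> and \<open>b\<close>. In coordinates \<open>x = s a + t b\<close> with \<open>s + t > 1\<close>, a negative
  \<open>s\<close> would push \<open>x\<close> across the line at \<open>b\<close>, and a negative \<open>t\<close> across the line at \<open>a\<close>.\<close>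

lemma cap_in_sector:
  assumes det: "det2 a b > 0" and d: "d > 0" and f: "f \<bullet> a = d" "f \<bullet> b \<le> d" and g: "g \<bullet> b = d" "g \<bullet> a \<le> d"
    and x: "f \<bullet> x \<le> d" "g \<bullet> x \<le> d" and beyond: "det2 (a - b) x > det2 a b"
  shows "det2 a x \<ge> 0 \<and> det2 x b \<ge> 0"
proof -
  define p q where "p = det2 x b" and "q = det2 a x"
  have comb: "det2 a b * (w \<bullet> x) = p * (w \<bullet> a) + q * (w \<bullet> b)" for w
    by (simp add: p_def q_def inner2 det2_def algebra_simps)
  have "det2 (a - b) x = p + q" by (simp add: p_def q_def det2_simps det2_swap[of b x])
  then have sum: "p + q > det2 a b" using beyond by simp
  have gx: "p * (g \<bullet> a) + q * d \<le> det2 a b * d"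
    using comb[of g] g(1) x(2) det by (metis mult_left_mono less_imp_le)
  have fx: "p * d + q * (f \<bullet> b) \<le> det2 a b * d"
    using comb[of f] f(1) x(1) det by (metis mult_left_mono less_imp_le)
  have sumd: "p * d + q * d > det2 a b * d" using sum d by (simp flip: distrib_right)
  have "p \<ge> 0"
  proof (rule ccontr)
    assume "\<not> p \<ge> 0"
    then have "p * (g \<bullet> a) \<ge> p * d" using g(2) by (intro mult_left_mono_neg) auto
    then show False using gx sumd by linarith
  qed
  moreover have "q \<ge> 0"
  proof (rule ccontr)
    assume "\<not> q \<ge> 0"
    then have "q * (f \<bullet> b) \<ge> q * d" using f(2) by (intro mult_left_mono_neg) auto
    then show False using fx sumd by linarith
  qed
  ultimately show ?thesis by (simp add: p_def q_def)
qed

lemma eq_0_of_orthogonal_pair: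
  fixes z :: "real^2"
  assumes "z \<bullet> a = 0" "z \<bullet> b = 0" "det2 a b \<noteq> 0" shows "z = 0"
proof -
  have "det2 a b * z$1 = (z \<bullet> a) * b$2 - (z \<bullet> b) * a$2"
    "det2 a b * z$2 = (z \<bullet> b) * a$1 - (z \<bullet> a) * b$1"
    by (simp_all add: inner2 det2_def algebra_simps)
  then show ?thesis using assms by (simp add: vec2_eq_iff)
qed

text \<open>The inner polygon has centre \<open>z\<close>, circumradius \<open>R\<close> and phase \<open>\<tau>\<close>; the outer one has inradius \<open>h\<close> and normals
  \<open>spoke n \<sigma> k\<close>. The equation \<open>R * cos (\<tau> - \<sigma>) = h\<close> says that the \<open>k\<close>-th vertex lies on the \<open>k\<close>-th side line, for one
  and hence for all \<open>k\<close>.\<close>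

locale body_between_ngons =
  fixes n :: nat and z :: "real^2" and R \<tau> \<sigma> h :: real and K :: "(real^2) set"
  assumes n: "n \<ge> 3" and R: "R > 0" and h: "h > 0" and h_eq: "R * cos (\<tau> - \<sigma>) = h"
    and K: "convex K" "compact K" "0 \<in> interior K"
    and vertices: "ngon n z R \<tau> \<subseteq> K"
    and sides: "\<And>x k. x \<in> K \<Longrightarrow> (x - z) \<bullet> spoke n \<sigma> k \<le> h"
begin

definition v :: "nat \<Rightarrow> real^2" where "v k = z + R *\<^sub>R spoke n \<tau> k"

text \<open>The signed distance from the origin to the \<open>k\<close>-th side line of the outer polygon.\<close>

definition ht :: "nat \<Rightarrow> real" where "ht k = h + z \<bullet> spoke n \<sigma> k"

definition u :: "nat \<Rightarrow> real^2" where "u k = (1 / ht k) *\<^sub>R spoke n \<sigma> k"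

text \<open>The distance from a vertex of the inner polygon to the next side line of the outer polygon; \<open>\<beta>\<close> is the distance to
  the previous one.\<close>

definition \<alpha> :: real where "\<alpha> = h - R * cos (\<tau> - \<sigma> - 2 * pi / real n)"

definition \<beta> :: real where "\<beta> = h - R * cos (\<tau> - \<sigma> + 2 * pi / real n)"

text \<open>Normalised to have mean 1, since the numbers \<open>ht k\<close> have mean \<open>h\<close>.\<close>

definition weight :: "nat \<Rightarrow> real" where
  "weight k = (\<alpha> * ht (Suc k) + \<beta> * ht k) / ((\<alpha> + \<beta>) * h)"

abbreviation A :: "nat \<Rightarrow> real" where "A k \<equiv> bulge K (v k) (v (Suc k))"

abbreviation B :: "nat \<Rightarrow> real" where "B k \<equiv> bulge (polar K) (u k) (u (Suc k))"

lemma K_lmeasurable: "K \<in> lmeasurable"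
  using K by (simp add: lmeasurable_compact)

lemma polar_K: "convex (polar K)" "compact (polar K)" "polar K \<in> lmeasurable" "0 \<in> interior (polar K)"
  using convex_polar compact_polar[OF K(3)] zero_interior_polar[OF compact_imp_bounded[OF K(2)]]
  by (auto simp: lmeasurable_compact)

lemma v_in: "k \<le> n \<Longrightarrow> v k \<in> K"
  using ngon_vertex_le[of n k z R \<tau>] vertices n by (auto simp: v_def)

lemma ht_pos: "ht k > 0"
proof -
  obtain e where e: "e > 0" "cball 0 e \<subseteq> K" using K(3) by (auto simp: mem_interior_cball)
  have "e *\<^sub>R spoke n \<sigma> k \<in> K" using e by (auto intro!: subsetD[OF e(2)])
  then have "(e *\<^sub>R spoke n \<sigma> k - z) \<bullet> spoke n \<sigma> k \<le> h" by (rule sides)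
  then have "e - z \<bullet> spoke n \<sigma> k \<le> h"
    by (simp add: inner_diff_left spoke_inner)
  then show ?thesis using e(1) unfolding ht_def by linarith
qed

lemma u_in: "u k \<in> polar K"
proof -
  have "spoke n \<sigma> k \<bullet> x \<le> ht k" if "x \<in> K" for x
    using sides[OF that, of k] by (simp add: ht_def inner_diff_left inner_commute)
  then show ?thesis using ht_pos[of k] by (auto simp: polar_def u_def)
qed

lemma v_last: "v n = v 0" and ht_last: "ht n = ht 0"
  using n spoke_last[of n] by (auto simp: v_def ht_def)

lemma ht_eq: "spoke n \<sigma> k \<bullet> v j = ht k - (h - R * cos (\<sigma> - \<tau> + 2 * pi * (real k - real j) / real n))"
  by (simp add: v_def ht_def inner_add_right spoke_inner inner_commute)

lemma spoke_v: "spoke n \<sigma> k \<bullet> v k = ht k"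
  using h_eq cos_minus[of "\<tau> - \<sigma>"] by (simp add: ht_eq)

lemma spoke_v_Suc: "spoke n \<sigma> k \<bullet> v (Suc k) = ht k - \<beta>"
  using cos_minus[of "\<tau> - \<sigma> + 2 * pi / real n"] by (simp add: ht_eq \<beta>_def algebra_simps)

lemma spoke_Suc_v: "spoke n \<sigma> (Suc k) \<bullet> v k = ht (Suc k) - \<alpha>"
  using cos_minus[of "\<tau> - \<sigma> - 2 * pi / real n"] by (simp add: ht_eq \<alpha>_def algebra_simps)

lemma u_v: "u k \<bullet> v k = 1" "u (Suc k) \<bullet> v k = 1 - \<alpha> / ht (Suc k)" "u k \<bullet> v (Suc k) = 1 - \<beta> / ht k"
  using ht_pos[of k] ht_pos[of "Suc k"]
  by (simp_all add: u_def spoke_v spoke_v_Suc spoke_Suc_v diff_divide_distrib)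

lemma \<alpha>_nonneg: "\<alpha> \<ge> 0" and \<beta>_nonneg: "\<beta> \<ge> 0"
proof -
  have "v 0 \<in> K" "v 1 \<in> K" using v_in n by auto
  then have "u (Suc 0) \<bullet> v 0 \<le> 1" "u 0 \<bullet> v (Suc 0) \<le> 1" using polarD[OF u_in] by auto
  then show "\<alpha> \<ge> 0" "\<beta> \<ge> 0" using ht_pos[of 0] ht_pos[of "Suc 0"]
    by (auto simp: u_v zero_le_divide_iff)
qed

lemma \<alpha>\<beta>: "\<alpha> + \<beta> = 4 * h * (sin (pi / real n))\<^sup>2"
proof -
  define \<delta> \<theta> where "\<delta> = \<tau> - \<sigma>" and "\<theta> = 2 * pi / real n"
  have "\<alpha> + \<beta> = 2 * h - 2 * (R * cos \<delta>) * cos \<theta>"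
    unfolding \<alpha>_def \<beta>_def \<delta>_def[symmetric] \<theta>_def[symmetric]
    by (simp add: cos_add cos_diff algebra_simps)
  moreover have "cos \<theta> = 1 - 2 * (sin (pi / real n))\<^sup>2"
    using cos_double_sin[of "pi / real n"] by (simp add: \<theta>_def)
  ultimately show ?thesis using h_eq by (simp add: \<delta>_def algebra_simps)
qed

lemma \<alpha>\<beta>_pos: "\<alpha> + \<beta> > 0"
  using \<alpha>\<beta> h sin_pi_div_pos[OF n] by simp

lemma chord_inner: "(v k - v (Suc k)) \<bullet> (u k - u (Suc k)) = \<alpha> / ht (Suc k) + \<beta> / ht k"
  using u_v[of k] u_v(1)[of "Suc k"] by (simp add: inner_diff_left inner_diff_right inner_commute)

lemma det_v: "det2 (v k - z) (v (Suc k) - z) = R\<^sup>2 * sin (2 * pi / real n)"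
  by (simp add: v_def det2_simps spoke_Suc_det2 power2_eq_square)

lemma det_u: "det2 (u k) (u (Suc k)) = sin (2 * pi / real n) / (ht k * ht (Suc k))"
  by (simp add: u_def det2_simps spoke_Suc_det2)

lemma det_u_pos: "det2 (u k) (u (Suc k)) > 0"
  using ht_pos[of k] ht_pos[of "Suc k"] sin_2pi_div_pos[OF n] by (simp add: det_u)

lemma det_v_pos: "det2 (v k - z) (v (Suc k) - z) > 0"
  using R sin_2pi_div_pos[OF n] by (simp add: det_v)

lemma distinct_neighbours: "v k \<noteq> v (Suc k)" "u k \<noteq> u (Suc k)"
  using det_v_pos[of k] det_u_pos[of k] by (auto simp: det2_self)

lemma A_pos: "k < n \<Longrightarrow> A k > 0" and B_pos: "B k > 0"
  using perp_chord_in_polar(1)[OF K v_in v_in distinct_neighbours(1), of k]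
    perp_dual_chord_in_body(1)[OF K u_in u_in distinct_neighbours(2), of k] by auto

lemma weight_pos: "weight k > 0"
proof -
  have "\<alpha> * ht (Suc k) + \<beta> * ht k > 0"
    using \<alpha>\<beta>_pos \<alpha>_nonneg \<beta>_nonneg ht_pos[of k] ht_pos[of "Suc k"]
    by (cases "\<alpha> = 0") (auto intro: add_pos_nonneg add_nonneg_pos)
  then show ?thesis using \<alpha>\<beta>_pos h by (simp add: weight_def)
qed

lemma sum_ht: "(\<Sum>k<n. ht k) = real n * h" "(\<Sum>k<n. ht (Suc k)) = real n * h"
proof -
  show 1: "(\<Sum>k<n. ht k) = real n * h"
    using spoke_sum[OF n] by (simp add: ht_def sum.distrib flip: inner_sum_right)
  have "(\<Sum>k<n. ht (Suc k)) - (\<Sum>k<n. ht k) = ht n - ht 0"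
    unfolding sum_subtractf[symmetric] by (rule sum_lessThan_telescope)
  then show "(\<Sum>k<n. ht (Suc k)) = real n * h" using 1 ht_last by simp
qed

lemma sum_weight: "(\<Sum>k<n. weight k) = real n"
proof -
  have "(\<Sum>k<n. weight k) = (\<alpha> * (\<Sum>k<n. ht (Suc k)) + \<beta> * (\<Sum>k<n. ht k)) / ((\<alpha> + \<beta>) * h)"
    by (simp add: weight_def sum_divide_distrib[symmetric] sum.distrib sum_distrib_left)
  also have "\<dots> = (real n * ((\<alpha> + \<beta>) * h)) / ((\<alpha> + \<beta>) * h)" by (simp add: sum_ht algebra_simps)
  finally show ?thesis using \<alpha>\<beta>_pos h by simp
qed

text \<open>The local estimate, with \<open>\<alpha> / h\<^sub>k\<^sub>+\<^sub>1 + \<beta> / h\<^sub>k \<ge> (\<alpha> + \<beta>)\<^sup>2 / (\<alpha> h\<^sub>k\<^sub>+\<^sub>1 + \<beta> h\<^sub>k)\<close> by convexity.\<close>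

lemma sector_product:
  assumes k: "k < n" shows "(2 * sin (pi / real n))\<^sup>2 \<le> A k * B k * weight k"
proof -
  define p q where "p = ht k" and "q = ht (Suc k)"
  have pq: "p > 0" "q > 0" using ht_pos by (auto simp: p_def q_def)
  have "(v k - v (Suc k)) \<bullet> (u k - u (Suc k)) \<le> A k * B k"
    by (rule bulge_product) (use K u_in v_in k distinct_neighbours in auto)
  then have le: "\<alpha> / q + \<beta> / p \<le> A k * B k" by (simp add: chord_inner p_def q_def)
  have "(\<alpha> + \<beta>)\<^sup>2 \<le> (\<alpha> / q + \<beta> / p) * (\<alpha> * q + \<beta> * p)"
  proof -
    have "(\<alpha> / q + \<beta> / p) * (\<alpha> * q + \<beta> * p) = (\<alpha> + \<beta>)\<^sup>2 + \<alpha> * \<beta> * ((p - q)\<^sup>2 / (p * q))"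
      using pq by (simp add: field_simps power2_eq_square)
    then show ?thesis using \<alpha>_nonneg \<beta>_nonneg pq by simp
  qed
  then have "(\<alpha> + \<beta>)\<^sup>2 / ((\<alpha> + \<beta>) * h) \<le> (\<alpha> / q + \<beta> / p) * (\<alpha> * q + \<beta> * p) / ((\<alpha> + \<beta>) * h)"
    using \<alpha>\<beta>_pos h by (intro divide_right_mono) auto
  also have "\<dots> = (\<alpha> / q + \<beta> / p) * weight k" by (simp add: weight_def p_def q_def)
  also have "\<dots> \<le> A k * B k * weight k" using le weight_pos[of k] by (intro mult_right_mono) auto
  finally have "(\<alpha> + \<beta>) / h \<le> A k * B k * weight k" using \<alpha>\<beta>_pos by (simp add: power2_eq_square)
  then show ?thesis using h by (simp add: \<alpha>\<beta> power_mult_distrib)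
qed

text \<open>The sectors are taken about \<open>z\<close>, whereas \<open>A k\<close> refers to the origin. The difference telescopes around the
  polygon.\<close>

lemma sum_A: "sum A {..<n} \<le> 2 * area K"
proof -
  have zK: "z \<in> K" using ngon_center_interior[OF n R, of z \<tau>] interior_subset vertices by blast
  have "(\<Sum>k<n. det2 (v k - z) (v (Suc k) - z) + 2 * area (cap K (v k) (v (Suc k)))) \<le> 2 * area K"
  proof (rule area_ge_triangles_and_caps[OF n K(1) K_lmeasurable zK, of v \<tau>])
    fix k x assume k: "k < n" and x: "x \<in> cap K (v k) (v (Suc k))"
    have x': "det2 (v k - z - (v (Suc k) - z)) (x - z) > det2 (v k - z) (v (Suc k) - z)"
      using x by (simp add: cap_def det2_def algebra_simps)
    show "det2 (v k - z) (x - z) \<ge> 0 \<and> det2 (x - z) (v (Suc k) - z) \<ge> 0"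
      using cap_in_sector[OF det_v_pos h _ _ _ _ _ _ x', of "spoke n \<sigma> k" "spoke n \<sigma> (Suc k)"]
        sides[of x k] sides[of x "Suc k"] sides[of "v (Suc k)" k] sides[of "v k" "Suc k"] v_in k x
        spoke_v[of k] spoke_v[of "Suc k"]
      by (auto simp: cap_def ht_def inner_diff_right inner_diff_left inner_commute)
  qed (use v_in R in \<open>auto simp: v_def\<close>)
  moreover have "A k = det2 (v k - z) (v (Suc k) - z) + 2 * area (cap K (v k) (v (Suc k))) +
      (det2 z (v (Suc k)) - det2 z (v k))" for k
    by (simp add: bulge_def det2_simps det2_swap[of _ z])
  moreover have "(\<Sum>k<n. det2 z (v (Suc k)) - det2 z (v k)) = 0"
    by (subst sum_lessThan_telescope[of "\<lambda>k. det2 z (v k)"]) (simp add: v_last)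
  ultimately show ?thesis by (simp add: sum.distrib)
qed

text \<open>The points \<open>u k\<close> are positive multiples of the equiangular normals, so here the sectors are taken about the
  origin.\<close>

lemma sum_B: "sum B {..<n} \<le> 2 * area (polar K)"
proof -
  have z0: "0 \<in> polar K" using polar_K(4) interior_subset by blast
  have "(\<Sum>k<n. det2 (u k - 0) (u (Suc k) - 0) + 2 * area (cap (polar K) (u k) (u (Suc k)))) \<le> 2 * area (polar K)"
  proof (rule area_ge_triangles_and_caps[OF n polar_K(1,3) z0, of u \<sigma>])
    fix k x assume k: "k < n" and x: "x \<in> cap (polar K) (u k) (u (Suc k))"
    then have x': "det2 (u k - u (Suc k)) x > det2 (u k) (u (Suc k))" and xp: "x \<in> polar K"
      by (auto simp: cap_def)
    have *: "u k \<bullet> v (Suc k) \<le> 1" "u (Suc k) \<bullet> v k \<le> 1" "x \<bullet> v k \<le> 1" "x \<bullet> v (Suc k) \<le> 1"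
      using polarD[OF u_in v_in] polarD[OF xp v_in] k by auto
    show "det2 (u k - 0) (x - 0) \<ge> 0 \<and> det2 (x - 0) (u (Suc k) - 0) \<ge> 0"
      using cap_in_sector[OF det_u_pos zero_less_one _ _ _ _ _ _ x', of "v k" "v (Suc k)"]
        u_v(1)[of k] u_v(1)[of "Suc k"] * by (simp add: inner_commute)
  next
    fix k show "\<exists>\<rho>>0. u k = 0 + \<rho> *\<^sub>R spoke n \<sigma> k"
      using ht_pos[of k] by (intro exI[of _ "1 / ht k"]) (simp add: u_def)
  qed (use u_in in auto)
  then show ?thesis by (simp add: bulge_def)
qed

lemma sum_A_sum_B: "(real n * (2 * sin (pi / real n)))\<^sup>2 \<le> sum A {..<n} * sum B {..<n}"
  by (rule weighted_cauchy_schwarz(1)[of n _ A B weight])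
    (use n A_pos B_pos weight_pos sum_weight sector_product sin_pi_div_pos[OF n] in auto)

lemma sum_A_sum_B_le: "sum A {..<n} * sum B {..<n} \<le> 4 * (area K * area (polar K))"
proof -
  have "sum A {..<n} * sum B {..<n} \<le> (2 * area K) * (2 * area (polar K))"
  proof (intro mult_mono sum_A sum_B)
    show "0 \<le> sum B {..<n}" by (intro sum_nonneg less_imp_le B_pos)
  qed (simp add: area_def)
  then show ?thesis by simp
qed

lemma volume_product_ge: "(real n)\<^sup>2 * (sin (pi / real n))\<^sup>2 \<le> area K * area (polar K)"
  using sum_A_sum_B sum_A_sum_B_le by (simp add: power_mult_distrib)

text \<open>Weight 1 means that \<open>z\<close> is orthogonal to \<open>\<alpha> n\<^sub>k\<^sub>+\<^sub>1 + \<beta> n\<^sub>k\<close>, where \<open>n\<^sub>k\<close> are the normals. These vectors arise from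
  one another by rotation through \<open>2 * pi / n\<close>, and two consecutive ones are linearly independent.\<close>

lemma center_eq_0_of_weights:
  assumes "\<And>k. k < n \<Longrightarrow> weight k = 1" shows "z = 0"
proof -
  define w where "w = (\<lambda>k. \<alpha> *\<^sub>R spoke n \<sigma> (Suc k) + \<beta> *\<^sub>R spoke n \<sigma> k)"
  have "z \<bullet> w k = 0" if "k < n" for k
  proof -
    have "\<alpha> * ht (Suc k) + \<beta> * ht k = (\<alpha> + \<beta>) * h"
      using assms[OF that] \<alpha>\<beta>_pos h by (simp add: weight_def field_simps)
    then show ?thesis by (simp add: w_def ht_def inner_add_right algebra_simps)
  qed
  then have z: "z \<bullet> w 0 = 0" "z \<bullet> w 1 = 0" using n by auto
  define \<theta> where "\<theta> = 2 * pi / real n"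
  have s: "sin \<theta> > 0" using sin_2pi_div_pos[OF n] by (simp add: \<theta>_def)
  have "cos \<theta> \<noteq> -1" 
  proof
    assume "cos \<theta> = -1"
    then have "(sin \<theta>)\<^sup>2 = 0" by (simp only: sin_squared_eq) simp
    then show False using s by simp
  qed
  then have c: "cos \<theta> > -1" using cos_ge_minus_one[of \<theta>] by linarith
  have D: "det2 (spoke n \<sigma> (Suc 0)) (spoke n \<sigma> (Suc 1)) = sin \<theta>"
    "det2 (spoke n \<sigma> 0) (spoke n \<sigma> (Suc 0)) = sin \<theta>"
    "det2 (spoke n \<sigma> 0) (spoke n \<sigma> (Suc 1)) = sin (2 * \<theta>)"
    by (simp_all add: spoke_det2 \<theta>_def)
  have "det2 (w 0) (w 1) = (\<alpha>\<^sup>2 + \<beta>\<^sup>2) * sin \<theta> + \<alpha> * \<beta> * sin (2 * \<theta>)"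
    using D by (simp add: w_def det2_simps power2_eq_square algebra_simps)
  also have "\<dots> = sin \<theta> * ((\<alpha> - \<beta>)\<^sup>2 + 2 * (\<alpha> * \<beta>) * (1 + cos \<theta>))"
    unfolding sin_double by (simp add: power2_eq_square algebra_simps)
  also have "\<dots> > 0"
  proof -
    have "(\<alpha> - \<beta>)\<^sup>2 + 2 * (\<alpha> * \<beta>) * (1 + cos \<theta>) > 0"
    proof (cases "\<alpha> = \<beta>")
      case True
      then have "\<alpha> > 0" "\<beta> > 0" using \<alpha>\<beta>_pos by auto
      then show ?thesis using c by (intro add_nonneg_pos) auto
    next
      case False
      then show ?thesis using c \<alpha>_nonneg \<beta>_nonneg by (intro add_pos_nonneg) auto
    qed
    then show ?thesis using s by simp
  qed
  finally have "det2 (w 0) (w 1) \<noteq> 0" by simp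
  then show ?thesis using eq_0_of_orthogonal_pair z by blast
qed

text \<open>All the \<open>A k\<close> agree, and so do the \<open>B k\<close> and, since \<open>z = 0\<close>, the triangles in them. Hence one empty cap of the
  polar body makes all its caps empty.\<close>

lemma equality_case:
  assumes eq: "area K * area (polar K) = (real n)\<^sup>2 * (sin (pi / real n))\<^sup>2"
  shows "z = 0" and "K \<subseteq> ngon n z R \<tau> \<or> {x. \<forall>k. (x - z) \<bullet> spoke n \<sigma> k \<le> h} \<subseteq> K"
proof -
  define s where "s = 2 * sin (pi / real n)"
  have s: "s > 0" using sin_pi_div_pos[OF n] by (simp add: s_def)
  have AB: "sum A {..<n} * sum B {..<n} = (real n * s)\<^sup>2"
  proof (rule antisym)
    have "4 * (area K * area (polar K)) = (real n * s)\<^sup>2"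
      unfolding eq by (simp add: s_def power_mult_distrib)
    then show "sum A {..<n} * sum B {..<n} \<le> (real n * s)\<^sup>2" using sum_A_sum_B_le by (simp only:)
    show "(real n * s)\<^sup>2 \<le> sum A {..<n} * sum B {..<n}" unfolding s_def by (rule sum_A_sum_B)
  qed
  have "weight k = 1 \<and> A k = sum A {..<n} / real n \<and> B k = sum B {..<n} / real n" if "k < n" for k
  proof (rule weighted_cauchy_schwarz(2)[of n s A B weight, OF _ s A_pos B_pos weight_pos sum_weight _ AB that])
    show "s\<^sup>2 \<le> A k * B k * weight k" if "k < n" for k
      using sector_product[OF that] by (simp only: s_def)
  qed (use n in simp)
  then have all: "weight k = 1" "A k = sum A {..<n} / real n" "B k = sum B {..<n} / real n"
    if "k < n" for k using that by blast+
  show z: "z = 0" using center_eq_0_of_weights all(1) by blast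
  have ht: "ht k = h" for k unfolding ht_def using z by simp
  have v0: "v k = R *\<^sub>R spoke n \<tau> k" for k unfolding v_def using z by simp
  have u0: "u k = (1 / h) *\<^sub>R spoke n \<sigma> k" for k unfolding u_def ht ..
  have det_v': "det2 (v k) (v (Suc k)) > 0" for k using det_v_pos[of k] z by simp
  have det_u': "det2 (u k) (u (Suc k)) = sin (2 * pi / real n) / h\<^sup>2" for k
    by (simp add: det_u ht power2_eq_square)
  \<comment> \<open>Every local estimate is sharp, as \<open>A k * B k\<close> is the common value \<open>4 sin\<^sup>2 (pi / n)\<close>.\<close>
  have dich: "cap K (v k) (v (Suc k)) = {} \<or> cap (polar K) (u k) (u (Suc k)) = {}" if k: "k < n" for k
  proof (rule bulge_product_equality[OF K])
    show "v k \<in> K" "v (Suc k) \<in> K" using v_in k by auto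
    show "det2 (v k) (v (Suc k)) > 0" by (rule det_v')
    have "A k * B k = s\<^sup>2"
    proof -
      have "A k * B k = (sum A {..<n} * sum B {..<n}) / (real n)\<^sup>2"
        unfolding all(2)[OF k] all(3)[OF k] by (simp only: times_divide_times_eq power2_eq_square)
      also have "\<dots> = s\<^sup>2" unfolding AB using n by (simp only: power_mult_distrib) simp
      finally show ?thesis .
    qed
    moreover have "(v k - v (Suc k)) \<bullet> (u k - u (Suc k)) = (\<alpha> + \<beta>) / h"
      by (simp add: chord_inner ht add_divide_distrib)
    ultimately show "(v k - v (Suc k)) \<bullet> (u k - u (Suc k)) = A k * B k"
      using h by (simp add: \<alpha>\<beta> s_def power_mult_distrib)
  qed (use u_in u_v in auto)
  show "K \<subseteq> ngon n z R \<tau> \<or> {x. \<forall>k. (x - z) \<bullet> spoke n \<sigma> k \<le> h} \<subseteq> K"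
  proof (cases "\<forall>k<n. cap K (v k) (v (Suc k)) = {}")
    case True
    have "K \<subseteq> ngon n z R \<tau>"
    proof
      fix x assume x: "x \<in> K"
      obtain k where k: "k < n" "det2 (spoke n \<tau> k) x \<ge> 0" "det2 x (spoke n \<tau> (Suc k)) \<ge> 0"
        using sectors_cover[OF n] by blast
      then have "det2 (v k) x \<ge> 0" "det2 x (v (Suc k)) \<ge> 0" using R by (auto simp: v0 det2_simps)
      then obtain a b where ab: "a \<ge> 0" "b \<ge> 0" "x = a *\<^sub>R v k + b *\<^sub>R v (Suc k)"
        using sector_coordinates[of "v k" "v (Suc k)" x] det_v'[of k] by metis
      have "x \<notin> cap K (v k) (v (Suc k))" using True k by auto
      then have "det2 (v k - v (Suc k)) x \<le> det2 (v k) (v (Suc k))" using x by (auto simp: cap_def)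
      moreover have "det2 (v k - v (Suc k)) x = (a + b) * det2 (v k) (v (Suc k))"
        by (simp add: ab(3) det2_simps det2_swap[of "v (Suc k)" "v k"] algebra_simps)
      ultimately have "a + b \<le> 1" using det_v'[of k] by simp
      then have "x \<in> convex hull {0, v k, v (Suc k)}" using in_triangle_at_origin[OF ab(1,2)] ab(3) by simp
      moreover have "convex hull {0, v k, v (Suc k)} \<subseteq> ngon n z R \<tau>"
      proof (intro hull_minimal convex_ngon)
        have "z \<in> ngon n z R \<tau>" using ngon_center_interior[OF n R, of z \<tau>] interior_subset by blast
        then have "0 \<in> ngon n z R \<tau>" using z by simp
        moreover have "v k \<in> ngon n z R \<tau>" "v (Suc k) \<in> ngon n z R \<tau>"
          unfolding v_def using k by (auto intro!: ngon_vertex_le)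
        ultimately show "{0, v k, v (Suc k)} \<subseteq> ngon n z R \<tau>" by simp
      qed
      ultimately show "x \<in> ngon n z R \<tau>" by auto
    qed
    then show ?thesis ..
  next
    case False
    then obtain k0 where k0: "k0 < n" "cap K (v k0) (v (Suc k0)) \<noteq> {}" by auto
    then have "cap (polar K) (u k0) (u (Suc k0)) = {}" using dich by auto
    then have "B k0 = sin (2 * pi / real n) / h\<^sup>2" by (simp add: bulge_def det_u' area_def)
    then have Bk: "B k = det2 (u k) (u (Suc k))" if "k < n" for k
      unfolding det_u' using all(3)[OF that] all(3)[OF k0(1)] by metis
    \<comment> \<open>The polar body is covered by the triangles over its chords, hence is the hull of the points \<open>u k\<close>.\<close>
    have "{x. \<forall>k. (x - z) \<bullet> spoke n \<sigma> k \<le> h} \<subseteq> polar (polar K)"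
    proof
      fix x assume x: "x \<in> {x. \<forall>k. (x - z) \<bullet> spoke n \<sigma> k \<le> h}"
      have ux: "u k \<bullet> x \<le> 1" for k
      proof -
        have "(x - z) \<bullet> spoke n \<sigma> k \<le> h" using x by blast
        then have "x \<bullet> spoke n \<sigma> k \<le> h" using z by simp
        then show ?thesis unfolding u0 using h by (simp add: inner_commute)
      qed
      have "x \<bullet> y \<le> 1" if y: "y \<in> polar K" for y
      proof -
        obtain k where k: "k < n" "det2 (spoke n \<sigma> k) y \<ge> 0" "det2 y (spoke n \<sigma> (Suc k)) \<ge> 0"
          using sectors_cover[OF n] by blast
        then have "det2 (u k) y \<ge> 0" "det2 y (u (Suc k)) \<ge> 0" using h by (auto simp: u0 det2_simps)
        then obtain a b where ab: "a \<ge> 0" "b \<ge> 0" "y = a *\<^sub>R u k + b *\<^sub>R u (Suc k)"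
          using sector_coordinates[of "u k" "u (Suc k)" y] det_u_pos[of k] by metis
        have "det2 (u k - u (Suc k)) y \<le> B k"
          unfolding bulge_def using chord_bound[OF polar_K(1,3) u_in u_in y] .
        moreover have "det2 (u k - u (Suc k)) y = (a + b) * det2 (u k) (u (Suc k))"
          by (simp add: ab(3) det2_simps det2_swap[of "u (Suc k)" "u k"] algebra_simps)
        ultimately have "a + b \<le> 1" using det_u_pos[of k] Bk[OF k(1)] by simp
        moreover have "x \<bullet> y \<le> a * 1 + b * 1"
          unfolding ab(3) inner_add_right inner_scaleR_right inner_commute[of x]
          using ux ab(1,2) by (intro add_mono mult_left_mono)
        ultimately show ?thesis by simp
      qed
      then show "x \<in> polar (polar K)" by (simp add: polar_def)
    qed
    also have "polar (polar K) = K"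
      using K interior_subset by (intro polar_polar) (auto simp: compact_imp_closed)
    finally show ?thesis ..
  qed
qed

end

theorem theorem3:
  fixes n :: nat and Ki Ko K :: "(real^2) set" and z :: "real^2"
  assumes "n \<ge> 3"
    and "regular_ngon n Ki" and "regular_ngon n Ko"
    and "\<And>v. v extreme_point_of Ki \<Longrightarrow> \<exists>S. S edge_of Ko \<and> v \<in> S"
    and "centroid Ki = z" and "centroid Ko = z"
    and "convex_body K" and "0 \<in> interior K"
    and "Ki \<subseteq> K" and "K \<subseteq> Ko"
  shows "area K * area (polar K) \<ge> (real n)\<^sup>2 * (sin (pi / real n))\<^sup>2
    \<and> (area K * area (polar K) = (real n)\<^sup>2 * (sin (pi / real n))\<^sup>2
        \<longleftrightarrow> 0 = z \<and> (K = Ki \<or> K = Ko))"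
proof -
  note n = assms(1)
  obtain R \<tau> where R: "R > 0" and Ki: "Ki = ngon n z R \<tau>"
    using assms(2,5) centroid_ngon[OF n] unfolding regular_ngon_iff by metis
  obtain R' t where R': "R' > 0" and Ko: "Ko = ngon n z R' t"
    using assms(3,6) centroid_ngon[OF n] unfolding regular_ngon_iff by metis
  define h where "h = R' * cos (pi / real n)"
  have h: "h > 0" using R' cos_pi_div_pos[OF n] by (simp add: h_def)
  obtain S where S: "S edge_of ngon n z R' t" "z + R *\<^sub>R spoke n \<tau> 0 \<in> S"
    using assms(4)[of "z + R *\<^sub>R spoke n \<tau> 0"] ngon_vertex_extreme[OF n R] unfolding Ki Ko by metis
  obtain j where j: "(z + R *\<^sub>R spoke n \<tau> 0 - z) \<bullet> spoke n (t + pi / real n) j = h"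
    using vertex_on_side[OF n R' S] by (metis h_def)
  \<comment> \<open>Renumber the sides so that vertex 0 lies on side 0.\<close>
  define \<sigma> where "\<sigma> = t + pi / real n + 2 * pi * real j / real n"
  have shift: "spoke n \<sigma> k = spoke n (t + pi / real n) (j + k)" for k
    by (simp add: spoke_def \<sigma>_def distrib_left add_divide_distrib add.assoc)
  interpret body_between_ngons n z R \<tau> \<sigma> h K
  proof
    have "(R *\<^sub>R spoke n \<tau> 0) \<bullet> spoke n \<sigma> 0 = h" using j shift[of 0] by simp
    then show "R * cos (\<tau> - \<sigma>) = h" by (simp add: spoke_inner)
    show "(x - z) \<bullet> spoke n \<sigma> k \<le> h" if "x \<in> K" for x k
      unfolding shift h_def using ngon_side_le[OF n R'] that assms(10) Ko by blast
    show "convex K" "compact K" using assms(7) by (simp_all add: convex_body_def)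
    show "ngon n z R \<tau> \<subseteq> K" using assms(9) Ki by simp
  qed (fact n R h assms(8))+
  have Ko_sub: "Ko \<subseteq> {x. \<forall>k. (x - z) \<bullet> spoke n \<sigma> k \<le> h}"
    unfolding shift h_def Ko using ngon_side_le[OF n R'] by blast
  have "0 = z \<and> (K = Ki \<or> K = Ko)" if "area K * area (polar K) = (real n)\<^sup>2 * (sin (pi / real n))\<^sup>2"
  proof -
    have "K \<subseteq> Ki \<or> Ko \<subseteq> K" using equality_case(2)[OF that] Ko_sub unfolding Ki by (meson subset_trans)
    then show ?thesis using equality_case(1)[OF that] assms(9,10) by (metis subset_antisym)
  qed
  moreover have "area K * area (polar K) = (real n)\<^sup>2 * (sin (pi / real n))\<^sup>2" if "0 = z \<and> (K = Ki \<or> K = Ko)"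
  proof (rule antisym)
    have "K = ngon n 0 R \<tau> \<or> K = ngon n 0 R' t" using that Ki Ko by metis
    then show "area K * area (polar K) \<le> (real n)\<^sup>2 * (sin (pi / real n))\<^sup>2"
      using ngon_volume_product_le[OF n R] ngon_volume_product_le[OF n R'] by metis
  qed (rule volume_product_ge)
  ultimately show ?thesis using volume_product_ge by blast
qed

end
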